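(* Let $a>0$, $b<0$, $b_X>0$ and $U_{\rm e}$ be real constants, with $b$ known, and consider the system, for $t\ge0$, $x\in[0,1]$, $$u_t(x,t)=b\,u_x(x,t)+b_XX(t),\qquad u(0,t)=2U_{\rm e}-U(t),$$ $$\dot X(t)=-aX(t)+V(t),\qquad \dot V(t)=0.$$ Let $\gamma,\gamma_3>0$ and $\bar A<0$. Consider the filters $$\dot\Omega_0(t)=\bar A\big(\Omega_0(t)-X(t)\big)+V(t),\qquad \dot\Omega(t)=\bar A\,\Omega(t)-X(t),$$ $$\mu_t(x,t)=b\,\mu_x(x,t)+X(t),\quad \mu(0,t)=0,$$ $$\xi_t(x,t)=b\,\xi_x(x,t),\quad \xi(0,t)=-U(t)+2U_{\rm e},$$ the prediction errors $$\hat\zeta(x,t)=u(x,t)-\hat b_X(t)\mu(x,t)-\xi(x,t),\qquad \hat\epsilon(t)=X(t)-\Omega_0(t)-\Omega(t)\hat a(t),$$ and the update laws $$\dot{\hat b}_X(t)=\gamma\frac{\int_0^1\hat\zeta(x,t)\mu(x,t)dx}{1+\int_0^1\mu(x,t)^2dx},\qquad \dot{\hat a}(t)=\gamma_3\frac{\hat\epsilon(t)\Omega(t)}{1+\Omega(t)^2}.$$ Put $\tilde b_X=b_X-\hat b_X$, $\tilde a=a-\hat a$. Then for all $V(0),X(0),\hat b_X(0),\hat a(0),\Omega(0),\Omega_0(0)\in\mathbb R$, all $u(\cdot,0),\mu(\cdot,0),\xi(\cdot,0)\in L_2(0,1)$, and all $U\in\mathcal L_\infty$, $$\|u\|,\ V,\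 X,\ \|\mu\|,\ \|\xi\|,\ \Omega,\ \Omega_0,\ \tilde b_X,\ \tilde a\in\mathcal L_\infty,\qquad \dot{\hat b}_X,\ \dot{\hat a}\in\mathcal L_2\cap\mathcal L_\infty,$$ $$\frac{\|\hat\zeta\|}{\sqrt{1+\|\mu\|^2}},\ \frac{|\hat\epsilon|}{\sqrt{1+\Omega^2}}\in\mathcal L_2\cap\mathcal L_\infty.$$ Moreover, if $V(0)=c$ with $c\neq0$, then $\lim_{t\to\infty}\hat b_X(t)=b_X$ and $\lim_{t\to\infty}\hat a(t)=a$.
   Context: $\|\cdot\|$ denotes the spatial $L_2(0,1)$ norm, so e.g. $\|u\|$ denotes the function of time $t\mapsto\big(\int_0^1u(x,t)^2dx\big)^{1/2}$. $\mathcal L_\infty$ and $\mathcal L_2$ denote the spaces of bounded, respectively square integrable, functions of time $t\ge0$. Subscripts $t,x$ denote partial derivatives and dots denote time derivatives. $\hat b_X,\hat a$ are the online estimates of the unknown constants $b_X,a$; the signals $u,X,V,U$ are measured. Transport equations with $L_2(0,1)$ initial data are understood in the usual weak/mild sense; since $b<0$, transport is from $x=0$ to $x=1$. *)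

theory Defs
  imports "HOL-Analysis.Analysis"
begin

definition L2_on :: "real set \<Rightarrow> (real \<Rightarrow> real) \<Rightarrow> bool" where
  "L2_on S f \<longleftrightarrow>
     f \<in> borel_measurable (lebesgue_on S) \<and> integrable (lebesgue_on S) (\<lambda>x. (f x)\<^sup>2)"

definition L2_norm :: "(real \<Rightarrow> real) \<Rightarrow> real" where
  "L2_norm f = sqrt (LINT x|lebesgue_on {0..1}. (f x)\<^sup>2)"

text \<open>Signals are functions on the whole real line, but only their values at times
  \<open>t \<ge> 0\<close> are relevant.\<close>

definition Linf_time :: "(real \<Rightarrow> real) \<Rightarrow> bool" where
  "Linf_time f \<longleftrightarrow> f \<in> borel_measurable (lebesgue_on {0..}) \<and> bounded (f ` {0..})"

abbreviation L2_time :: "(real \<Rightarrow> real) \<Rightarrow> bool" where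
  "L2_time \<equiv> L2_on {0..}"

text \<open>One-sided at \<open>t = 0\<close>.\<close>

abbreviation has_time_derivative :: "(real \<Rightarrow> real) \<Rightarrow> (real \<Rightarrow> real) \<Rightarrow> bool" where
  "has_time_derivative f f' \<equiv> (\<forall>t\<ge>0. (f has_real_derivative f' t) (at t within {0..}))"

abbreviation time_derivative :: "(real \<Rightarrow> real) \<Rightarrow> real \<Rightarrow> real" where
  "time_derivative f t \<equiv> vector_derivative f (at t within {0..})"

text \<open>\<open>\<phi>\<close> is continuously differentiable on the closed rectangle \<open>{0..1} \<times> {0..T}\<close>
  with partial derivatives \<open>\<phi>x\<close> and \<open>\<phi>t\<close> (one-sided on the boundary).\<close>

definition C1_on_rectangle ::
  "real \<Rightarrow> (real \<Rightarrow> real \<Rightarrow> real) \<Rightarrow> (real \<Rightarrow> real \<Rightarrow> real) \<Rightarrow> (real \<Rightarrow> real \<Rightarrow> real) \<Rightarrow> bool" where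
  "C1_on_rectangle T \<phi> \<phi>x \<phi>t \<longleftrightarrow>
     (\<forall>x\<in>{0..1}. \<forall>t\<in>{0..T}.
        ((\<lambda>y. \<phi> y t) has_real_derivative \<phi>x x t) (at x within {0..1}) \<and>
        ((\<lambda>s. \<phi> x s) has_real_derivative \<phi>t x t) (at t within {0..T})) \<and>
     continuous_on ({0..1} \<times> {0..T}) (\<lambda>(x, t). \<phi>x x t) \<and>
     continuous_on ({0..1} \<times> {0..T}) (\<lambda>(x, t). \<phi>t x t)"

text \<open>Weak solutions \<open>w \<in> C([0,\<infinity>); L\<^sub>2(0,1))\<close> of
  \<open>w\<^sub>t(x,t) = b w\<^sub>x(x,t) + f(t)\<close>, \<open>w(0,t) = g(t)\<close>, for \<open>b < 0\<close>. The integral identity is the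
  equation multiplied by \<open>\<phi>\<close> and integrated by parts over \<open>[0,1] \<times> [0,T]\<close>; the test
  functions vanish at the outflow boundary \<open>x = 1\<close>, where \<open>w\<close> has no prescribed trace.
  The initial value is \<open>w(\<cdot>,0)\<close>, an arbitrary element of \<open>L\<^sub>2(0,1)\<close>.\<close>

definition transport_solution ::
  "real \<Rightarrow> (real \<Rightarrow> real) \<Rightarrow> (real \<Rightarrow> real) \<Rightarrow> (real \<Rightarrow> real \<Rightarrow> real) \<Rightarrow> bool" where
  "transport_solution b f g w \<longleftrightarrow>
     (\<forall>t\<ge>0. L2_on {0..1} (\<lambda>x. w x t)) \<and>
     (\<forall>t\<ge>0. ((\<lambda>s. L2_norm (\<lambda>x. w x s - w x t)) \<longlongrightarrow> 0) (at t within {0..})) \<and>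
     (\<forall>T>0. \<forall>\<phi> \<phi>x \<phi>t. C1_on_rectangle T \<phi> \<phi>x \<phi>t \<and> (\<forall>t\<in>{0..T}. \<phi> 1 t = 0) \<longrightarrow>
        (LINT x|lebesgue_on {0..1}. w x T * \<phi> x T) - (LINT x|lebesgue_on {0..1}. w x 0 * \<phi> x 0) =
        (LINT t|lebesgue_on {0..T}.
           (LINT x|lebesgue_on {0..1}. w x t * (\<phi>t x t - b * \<phi>x x t))
           + f t * (LINT x|lebesgue_on {0..1}. \<phi> x t)
           - b * g t * \<phi> 0 t))"

end

theory Submission
  imports Defs
begin

text \<open>\<^bold>\<open>Finite dimensional part.\<close> Since \<open>V\<close> is constant, \<open>X\<close> and the filter state \<open>\<Omega>\<close> converge, with
  limits \<open>c / a\<close> and \<open>c / (a Abar)\<close> for \<open>c = V(0)\<close>. The filters are built such that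
  \<open>\<eta> = X - \<Omega>\<^sub>0 - a \<Omega>\<close> solves \<open>\<eta>' = Abar \<eta>\<close>, so the prediction error is
  \<open>\<epsilon> = (a - ahat) \<Omega> + \<eta>\<close>: linear in the parameter error, up to a disturbance of finite energy.

  \<^bold>\<open>Transport part.\<close> In the same way \<open>e = u - b\<^sub>X \<mu> - \<xi>\<close> solves the transport equation with
  zero source and zero inflow, and \<open>\<zeta> = e + (b\<^sub>X - bhat\<^sub>X) \<mu>\<close>. Transport with speed \<open>-b\<close> empties the
  unit interval in time \<open>-1/b\<close>, so \<open>e\<close> vanishes from that time on and again has finite energy. From
  then on the state \<open>\<mu>(\<cdot>,t)\<close> only remembers \<open>X\<close> on the window \<open>[t + 1/b, t]\<close>. It is bounded because \<open>X\<close> is, and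
  bounded away from zero once \<open>X\<close> keeps one sign and stays away from zero, which happens if
  \<open>c \<noteq> 0\<close>.

  \<^bold>\<open>Estimators.\<close> Both update laws are normalized gradient laws. For the error \<open>\<theta>\<close> of either one
  the derivative of \<open>\<theta>\<^sup>2\<close> is at most \<open>-\<gamma> P + \<gamma> Q\<close>, where \<open>P\<close> is the squared normalized prediction
  error and \<open>Q\<close> is the squared disturbance; integrating in time bounds \<open>\<theta>\<close> and the energy of \<open>P\<close>
  (\<open>normalized_gradient_estimator\<close>), and everything else about the estimators is dominated by \<open>P\<close>
  (\<open>signal_in_L2_and_Linf\<close>). If the regressor stays away from zero, then \<open>\<theta>\<close> obeys a linear
  equation with damping bounded from below and vanishing forcing, hence tends to zero
  (\<open>tendsto_zero_of_linear_damping\<close>).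

  \<^bold>\<open>Weak solutions.\<close> The norm bounds, the extinction of \<open>e\<close> and the lower bound on \<open>\<mu>\<close> come from the test functions
  \<open>\<phi>(x,t) = \<psi>(x - b (T - t))\<close>, which are constant along characteristics. They turn the weak
  identity into a formula for \<open>\<integral> w(x,T) \<psi>(x) dx\<close> in terms of the initial value, the source and
  the inflow (\<open>transport_solution_imp_mild\<close>). A bound on these pairings in terms of the norm
  of \<open>\<psi>\<close> bounds the norm of \<open>w(\<cdot>,T)\<close>, as the admissible \<open>\<psi>\<close> are dense
  (\<open>L2_norm_le_by_duality\<close>).\<close>

section \<open>Square integrable functions on the unit interval\<close>

lemma integrable_mult_of_squares:
  fixes f g :: "'a \<Rightarrow> real"
  assumes [measurable]: "f \<in> borel_measurable M" "g \<in> borel_measurable M"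
    and "integrable M (\<lambda>x. (f x)\<^sup>2)" "integrable M (\<lambda>x. (g x)\<^sup>2)"
  shows "integrable M (\<lambda>x. f x * g x)"
proof (rule Bochner_Integration.integrable_bound)
  show "integrable M (\<lambda>x. (f x)\<^sup>2 + (g x)\<^sup>2)"
    using assms by simp
  have "\<bar>p * q\<bar> \<le> \<bar>p\<^sup>2 + q\<^sup>2\<bar>" for p q :: real
  proof -
    have "0 \<le> (\<bar>p\<bar> - \<bar>q\<bar>)\<^sup>2" by simp
    then have "2 * \<bar>p * q\<bar> \<le> p\<^sup>2 + q\<^sup>2"
      by (simp add: power2_diff abs_mult)
    then show ?thesis by simp
  qed
  then show "AE x in M. norm (f x * g x) \<le> norm ((f x)\<^sup>2 + (g x)\<^sup>2)"
    by simp
qed measurable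

lemma L2_on_mult_integrable:
  "L2_on S f \<Longrightarrow> L2_on S g \<Longrightarrow> integrable (lebesgue_on S) (\<lambda>x. f x * g x)"
  unfolding L2_on_def by (rule integrable_mult_of_squares) auto

lemma L2_on_lincomb:
  assumes "L2_on S f" "L2_on S g"
  shows "L2_on S (\<lambda>x. f x + c * g x)"
proof -
  have "integrable (lebesgue_on S) (\<lambda>x. (f x)\<^sup>2 + 2 * c * (f x * g x) + c\<^sup>2 * (g x)\<^sup>2)"
    using assms L2_on_mult_integrable[OF assms]
    by (intro Bochner_Integration.integrable_add integrable_mult_right) (auto simp: L2_on_def)
  then show ?thesis
    using assms
    by (auto simp: L2_on_def power2_sum power_mult_distrib algebra_simps
        intro!: borel_measurable_add borel_measurable_times)
qed

lemma L2_on_add: "L2_on S f \<Longrightarrow> L2_on S g \<Longrightarrow> L2_on S (\<lambda>x. f x + g x)"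
  using L2_on_lincomb[of S f g 1] by simp

lemma L2_on_diff: "L2_on S f \<Longrightarrow> L2_on S g \<Longrightarrow> L2_on S (\<lambda>x. f x - g x)"
  using L2_on_lincomb[of S f g "-1"] by simp

lemma L2_on_scale: "L2_on S f \<Longrightarrow> L2_on S (\<lambda>x. c * f x)"
  by (auto simp: L2_on_def power_mult_distrib intro!: borel_measurable_times)

lemma L2_norm_nonneg: "0 \<le> L2_norm f"
  by (simp add: L2_norm_def)

lemma L2_norm_square: "(L2_norm f)\<^sup>2 = (LINT x|lebesgue_on {0..1}. (f x)\<^sup>2)"
  by (simp add: L2_norm_def)

lemma L2_norm_cong: "(\<And>x. x \<in> {0..1} \<Longrightarrow> f x = g x) \<Longrightarrow> L2_norm f = L2_norm g"
  unfolding L2_norm_def by (intro arg_cong[where f = sqrt] Bochner_Integration.integral_cong) auto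

lemma L2_norm_scale: "L2_norm (\<lambda>x. c * f x) = \<bar>c\<bar> * L2_norm f"
  by (simp add: L2_norm_def power_mult_distrib real_sqrt_mult)

text \<open>The quadratic \<open>s \<mapsto> \<parallel>f + s g\<parallel>\<^sup>2\<close> is nonnegative, so its discriminant is not positive.\<close>

lemma L2_Cauchy_Schwarz:
  assumes f: "L2_on {0..1} f" and g: "L2_on {0..1} g"
  shows "\<bar>LINT x|lebesgue_on {0..1}. f x * g x\<bar> \<le> L2_norm f * L2_norm g"
proof -
  let ?M = "lebesgue_on {0..1::real}"
  define A where "A = (LINT x|?M. (f x)\<^sup>2)"
  define B where "B = (LINT x|?M. f x * g x)"
  define C where "C = (LINT x|?M. (g x)\<^sup>2)"
  have q: "0 \<le> A + 2 * s * B + s\<^sup>2 * C" for s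
  proof -
    have "A + 2 * s * B + s\<^sup>2 * C = (LINT x|?M. (f x)\<^sup>2 + 2 * s * (f x * g x) + s\<^sup>2 * (g x)\<^sup>2)"
      using f g L2_on_mult_integrable[OF f g] by (simp add: A_def B_def C_def L2_on_def)
    also have "\<dots> = (LINT x|?M. (f x + s * g x)\<^sup>2)"
      by (intro Bochner_Integration.integral_cong) (auto simp: power2_sum algebra_simps power_mult_distrib)
    finally show ?thesis by simp
  qed
  have "B\<^sup>2 \<le> A * C"
  proof (cases "C = 0")
    case False
    moreover have "C \<ge> 0" by (simp add: C_def)
    ultimately have C: "C > 0" by simp
    have e: "A + 2 * (- B / C) * B + (- B / C)\<^sup>2 * C = A - B\<^sup>2 / C"
      using C by (simp add: power2_eq_square field_simps)
    then show ?thesis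
      using q[of "- B / C", unfolded e] C by (simp add: pos_divide_le_eq)
  next
    case True
    have "B = 0"
    proof (rule ccontr)
      assume B: "B \<noteq> 0"
      have "0 \<le> A + 2 * (- (A + 1) / B) * B"
        using q[of "- (A + 1) / B"] True by simp
      moreover have "A \<ge> 0" by (simp add: A_def)
      ultimately show False using B by simp
    qed
    then show ?thesis using True by simp
  qed
  then have "\<bar>B\<bar> \<le> sqrt (A * C)"
    by (metis real_sqrt_abs real_sqrt_le_iff)
  then show ?thesis
    by (simp add: A_def B_def C_def L2_norm_def real_sqrt_mult)
qed

lemma L2_norm_triangle:
  assumes f: "L2_on {0..1} f" and g: "L2_on {0..1} g"
  shows "L2_norm (\<lambda>x. f x + g x) \<le> L2_norm f + L2_norm g"
proof (rule power2_le_imp_le)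
  let ?M = "lebesgue_on {0..1::real}"
  have "(L2_norm (\<lambda>x. f x + g x))\<^sup>2 = (LINT x|?M. (f x)\<^sup>2 + 2 * (f x * g x) + (g x)\<^sup>2)"
    unfolding L2_norm_square by (intro Bochner_Integration.integral_cong) (auto simp: power2_sum)
  also have "\<dots> = (L2_norm f)\<^sup>2 + 2 * (LINT x|?M. f x * g x) + (L2_norm g)\<^sup>2"
    using f g L2_on_mult_integrable[OF f g] by (simp add: L2_norm_square L2_on_def)
  also have "\<dots> \<le> (L2_norm f + L2_norm g)\<^sup>2"
    using L2_Cauchy_Schwarz[OF f g] by (simp add: power2_sum)
  finally show "(L2_norm (\<lambda>x. f x + g x))\<^sup>2 \<le> (L2_norm f + L2_norm g)\<^sup>2" .
qed (simp add: L2_norm_nonneg)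

text \<open>The first two clauses of the definition of a transport solution: membership in
  \<open>C([0,\<infinity>); L\<^sub>2(0,1))\<close>, without any reference to the equation.\<close>

definition L2_curve :: "(real \<Rightarrow> real \<Rightarrow> real) \<Rightarrow> bool" where
  "L2_curve w \<longleftrightarrow>
     (\<forall>t\<ge>0. L2_on {0..1} (\<lambda>x. w x t)) \<and>
     (\<forall>t\<ge>0. ((\<lambda>s. L2_norm (\<lambda>x. w x s - w x t)) \<longlongrightarrow> 0) (at t within {0..}))"

text \<open>The increment of \<open>c v\<close> is \<open>c(s) (v(s) - v(t)) + (c(s) - c(t)) v(t)\<close>, and both terms tend to
  zero in norm. This puts the prediction error \<open>\<zeta>\<close>, whose coefficient \<open>bhat\<^sub>X\<close> is time dependent,
  among the \<open>L\<^sub>2\<close>-continuous curves.\<close>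

lemma L2_curve_lincomb:
  assumes w: "L2_curve w" and v: "L2_curve v" and c: "continuous_on {0..} c"
  shows "L2_curve (\<lambda>x t. w x t + c t * v x t)"
  unfolding L2_curve_def
proof (intro conjI allI impI)
  fix t :: real assume t: "t \<ge> 0"
  note L2 = w[unfolded L2_curve_def, THEN conjunct1, rule_format]
    v[unfolded L2_curve_def, THEN conjunct1, rule_format]
  note L = w[unfolded L2_curve_def, THEN conjunct2, rule_format, OF t]
    v[unfolded L2_curve_def, THEN conjunct2, rule_format, OF t]
  show "L2_on {0..1} (\<lambda>x. w x t + c t * v x t)"
    using t L2 by (intro L2_on_lincomb) auto
  have ct: "(c \<longlongrightarrow> c t) (at t within {0..})"
    using c t by (auto simp: continuous_on_def)
  show "((\<lambda>s. L2_norm (\<lambda>x. (w x s + c s * v x s) - (w x t + c t * v x t))) \<longlongrightarrow> 0) (at t within {0..})"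
  proof (rule tendsto_sandwich[where f = "\<lambda>_. 0"])
    let ?h = "\<lambda>s. L2_norm (\<lambda>x. w x s - w x t) +
       (\<bar>c s\<bar> * L2_norm (\<lambda>x. v x s - v x t) + \<bar>c s - c t\<bar> * L2_norm (\<lambda>x. v x t))"
    have "(?h \<longlongrightarrow> 0 + (\<bar>c t\<bar> * 0 + \<bar>c t - c t\<bar> * L2_norm (\<lambda>x. v x t))) (at t within {0..})"
      by (intro tendsto_intros L ct)
    then show "(?h \<longlongrightarrow> 0) (at t within {0..})" by simp
    show "\<forall>\<^sub>F s in at t within {0..}.
        L2_norm (\<lambda>x. (w x s + c s * v x s) - (w x t + c t * v x t)) \<le> ?h s"
      unfolding eventually_at_filter
    proof (intro always_eventually allI impI)
      fix s :: real assume "s \<in> {0..}"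
      then have s: "s \<ge> 0" by simp
      have *: "(\<lambda>x. (w x s + c s * v x s) - (w x t + c t * v x t)) =
          (\<lambda>x. (w x s - w x t) + (c s * (v x s - v x t) + (c s - c t) * v x t))"
        by (auto simp: algebra_simps)
      have "L2_norm (\<lambda>x. (w x s + c s * v x s) - (w x t + c t * v x t)) \<le>
          L2_norm (\<lambda>x. w x s - w x t) +
          L2_norm (\<lambda>x. c s * (v x s - v x t) + (c s - c t) * v x t)"
        unfolding * using s t by (intro L2_norm_triangle L2_on_add L2_on_scale L2_on_diff L2) auto
      also have "L2_norm (\<lambda>x. c s * (v x s - v x t) + (c s - c t) * v x t) \<le>
          L2_norm (\<lambda>x. c s * (v x s - v x t)) + L2_norm (\<lambda>x. (c s - c t) * v x t)"
        using s t by (intro L2_norm_triangle L2_on_add L2_on_scale L2_on_diff L2) auto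
      finally show "L2_norm (\<lambda>x. (w x s + c s * v x s) - (w x t + c t * v x t)) \<le> ?h s"
        by (simp add: L2_norm_scale)
    qed
  qed (auto intro!: always_eventually simp: L2_norm_nonneg)
qed

text \<open>Supplies the continuity in time, hence measurability, of the right hand side of the update law
  and of all spatial norms.\<close>

lemma L2_curve_inner_continuous:
  assumes w: "L2_curve w" and v: "L2_curve v"
  shows "continuous_on {0..} (\<lambda>t. LINT x|lebesgue_on {0..1}. w x t * v x t)"
  unfolding continuous_on_def
proof
  fix t :: real assume "t \<in> {0..}"
  then have t: "t \<ge> 0" by simp
  let ?I = "\<lambda>t. LINT x|lebesgue_on {0..1}. w x t * v x t"
  note L2 = w[unfolded L2_curve_def, THEN conjunct1, rule_format]
    v[unfolded L2_curve_def, THEN conjunct1, rule_format]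
  note L = w[unfolded L2_curve_def, THEN conjunct2, rule_format, OF t]
    v[unfolded L2_curve_def, THEN conjunct2, rule_format, OF t]
  have "((\<lambda>s. ?I s - ?I t) \<longlongrightarrow> 0) (at t within {0..})"
  proof (rule tendsto_rabs_zero_cancel, rule tendsto_sandwich[where f = "\<lambda>_. 0"])
    let ?h = "\<lambda>s. (L2_norm (\<lambda>x. w x t) + L2_norm (\<lambda>x. w x s - w x t)) * L2_norm (\<lambda>x. v x s - v x t)
       + L2_norm (\<lambda>x. w x s - w x t) * L2_norm (\<lambda>x. v x t)"
    have "(?h \<longlongrightarrow> (L2_norm (\<lambda>x. w x t) + 0) * 0 + 0 * L2_norm (\<lambda>x. v x t)) (at t within {0..})"
      by (intro tendsto_intros L)
    then show "(?h \<longlongrightarrow> 0) (at t within {0..})" by simp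
    show "\<forall>\<^sub>F s in at t within {0..}. \<bar>?I s - ?I t\<bar> \<le> ?h s"
      unfolding eventually_at_filter
    proof (intro always_eventually allI impI)
      fix s :: real assume "s \<in> {0..}"
      then have s: "s \<ge> 0" by simp
      let ?M = "lebesgue_on {0..1::real}"
      let ?J = "LINT x|?M. w x s * (v x s - v x t)" and ?K = "LINT x|?M. (w x s - w x t) * v x t"
      have int: "integrable ?M (\<lambda>x. w x p * v x q)" if "p \<ge> 0" "q \<ge> 0" for p q
        using that by (intro L2_on_mult_integrable L2)
      have "?I s - ?I t = ?J + ?K"
        using s t int by (simp add: left_diff_distrib right_diff_distrib)
      moreover have "\<bar>?J\<bar> \<le> L2_norm (\<lambda>x. w x s) * L2_norm (\<lambda>x. v x s - v x t)"
        using s t by (intro L2_Cauchy_Schwarz L2_on_diff L2) auto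
      moreover have "\<bar>?K\<bar> \<le> L2_norm (\<lambda>x. w x s - w x t) * L2_norm (\<lambda>x. v x t)"
        using s t by (intro L2_Cauchy_Schwarz L2_on_diff L2) auto
      moreover have "L2_norm (\<lambda>x. w x s) \<le> L2_norm (\<lambda>x. w x t) + L2_norm (\<lambda>x. w x s - w x t)"
        using L2_norm_triangle[OF L2(1)[OF t] L2_on_diff[OF L2(1)[OF s] L2(1)[OF t]]] by simp
      then have "L2_norm (\<lambda>x. w x s) * L2_norm (\<lambda>x. v x s - v x t) \<le>
          (L2_norm (\<lambda>x. w x t) + L2_norm (\<lambda>x. w x s - w x t)) * L2_norm (\<lambda>x. v x s - v x t)"
        by (rule mult_right_mono) (rule L2_norm_nonneg)
      ultimately show "\<bar>?I s - ?I t\<bar> \<le> ?h s" by linarith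
    qed
  qed (auto intro!: always_eventually)
  then show "(?I \<longlongrightarrow> ?I t) (at t within {0..})"
    by (rule LIM_zero_cancel)
qed

lemma L2_curve_norm_continuous:
  assumes "L2_curve w"
  shows "continuous_on {0..} (\<lambda>t. L2_norm (\<lambda>x. w x t))"
  unfolding L2_norm_def power2_eq_square
  by (intro continuous_intros L2_curve_inner_continuous assms)

section \<open>Damped and dissipative scalar equations\<close>
lemma has_time_derivative_subset:
  assumes "has_time_derivative f f'" "t \<ge> 0" "S \<subseteq> {0..}"
  shows "(f has_real_derivative f' t) (at t within S)"
  using assms has_field_derivative_subset by blast

text \<open>As soon as \<open>d < \<kappa> \<delta>\<close>, the function \<open>(y - \<delta>) exp (\<kappa> t)\<close> is nonincreasing, so \<open>y\<close> eventually stays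
  below \<open>2 \<delta>\<close>.\<close>

lemma tendsto_zero_of_dissipation:
  fixes y :: "real \<Rightarrow> real"
  assumes der: "\<And>t. t \<ge> T \<Longrightarrow> (y has_real_derivative y' t) (at t within {T..})"
    and le: "\<And>t. t \<ge> T \<Longrightarrow> y' t \<le> - \<kappa> * y t + d t"
    and pos: "\<And>t. t \<ge> T \<Longrightarrow> 0 \<le> y t" and "\<kappa> > 0" and d: "(d \<longlongrightarrow> 0) at_top"
  shows "(y \<longlongrightarrow> 0) at_top"
proof (rule tendstoI)
  fix e :: real assume "e > 0"
  define \<delta> where "\<delta> = e / 2"
  have \<delta>: "\<delta> > 0" "\<kappa> * \<delta> > 0" using \<open>e > 0\<close> \<open>\<kappa> > 0\<close> by (auto simp: \<delta>_def)
  have "\<forall>\<^sub>F t in at_top. d t < \<kappa> * \<delta>"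
    using d \<delta>(2) by (rule order_tendstoD(2))
  then obtain S0 where S0: "\<And>t. t \<ge> S0 \<Longrightarrow> d t < \<kappa> * \<delta>"
    by (auto simp: eventually_at_top_linorder)
  define S where "S = max S0 T"
  define z where "z = (\<lambda>t. (y t - \<delta>) * exp (\<kappa> * t))"
  have z: "z t \<le> z S" if "t \<ge> S" for t
  proof (rule DERIV_nonpos_imp_decreasing_open[where f = z and a = S and b = t])
    show "S \<le> t" by fact
    have sub: "{S..t} \<subseteq> {T..}" by (auto simp: S_def)
    show "continuous_on {S..t} z"
      unfolding z_def
      by (intro continuous_intros continuous_on_subset[OF _ sub] DERIV_continuous_on[OF der]) auto
    fix s assume s: "S < s" "s < t"
    then have "(y has_real_derivative y' s) (at s)"
      using der[of s] at_within_interior[of s "{T..}"] by (simp add: S_def)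
    then have "(z has_real_derivative y' s * exp (\<kappa> * s) + (y s - \<delta>) * (exp (\<kappa> * s) * \<kappa>)) (at s)"
      unfolding z_def by (auto intro!: derivative_eq_intros)
    moreover have "y' s + (y s - \<delta>) * \<kappa> \<le> 0"
      using le[of s] S0[of s] s by (simp add: S_def algebra_simps)
    then have "(y' s + (y s - \<delta>) * \<kappa>) * exp (\<kappa> * s) \<le> 0"
      by (simp add: mult_le_0_iff)
    then have "y' s * exp (\<kappa> * s) + (y s - \<delta>) * (exp (\<kappa> * s) * \<kappa>) \<le> 0"
      by (simp add: algebra_simps)
    ultimately show "\<exists>y. (z has_real_derivative y) (at s) \<and> y \<le> 0" by blast
  qed
  have bound: "y t \<le> \<delta> + z S * exp (- (\<kappa> * t))" if "t \<ge> S" for t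
  proof -
    have "y t - \<delta> = z t * exp (- (\<kappa> * t))"
      by (simp add: z_def exp_minus field_simps)
    also have "\<dots> \<le> z S * exp (- (\<kappa> * t))"
      using z[OF that] by simp
    finally show ?thesis by simp
  qed
  have "LIM t at_top. \<kappa> * t :> at_top"
    using \<open>\<kappa> > 0\<close> by (intro filterlim_tendsto_pos_mult_at_top[OF tendsto_const]) (auto intro: filterlim_ident)
  then have "((\<lambda>t. exp (- (\<kappa> * t))) \<longlongrightarrow> 0) at_top"
    by (intro filterlim_compose[OF exp_at_bot]) (simp add: filterlim_uminus_at_top[symmetric] filterlim_uminus_at_bot)
  then have "((\<lambda>t. \<delta> + z S * exp (- (\<kappa> * t))) \<longlongrightarrow> \<delta> + z S * 0) at_top"
    by (intro tendsto_intros)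
  then have "\<forall>\<^sub>F t in at_top. \<delta> + z S * exp (- (\<kappa> * t)) < e"
    by (rule order_tendstoD(2)) (use \<open>e > 0\<close> in \<open>simp add: \<delta>_def\<close>)
  then show "\<forall>\<^sub>F t in at_top. dist (y t) 0 < e"
    using eventually_ge_at_top[of S]
  proof eventually_elim
    case (elim t)
    then show ?case using bound[of t] pos[of t] by (simp add: S_def)
  qed
qed

text \<open>By Young's inequality \<open>\<theta>\<^sup>2\<close> dissipates at rate \<open>\<gamma> l\<close>, up to the vanishing forcing
  \<open>\<gamma> r\<^sup>2 / l\<close>. The stable filters are the case \<open>m = 1\<close>; for the estimators \<open>m\<close> is the squared
  regressor, normalized.\<close>

lemma tendsto_zero_of_linear_damping:
  fixes \<theta> :: "real \<Rightarrow> real"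
  assumes der: "\<And>t. t \<ge> T \<Longrightarrow> (\<theta> has_real_derivative - \<gamma> * (m t * \<theta> t + r t)) (at t within {T..})"
    and m: "\<And>t. t \<ge> T \<Longrightarrow> l \<le> m t" and "l > 0" "\<gamma> > 0" and r: "(r \<longlongrightarrow> 0) at_top"
  shows "(\<theta> \<longlongrightarrow> 0) at_top"
proof -
  have "((\<lambda>t. (\<theta> t)\<^sup>2) \<longlongrightarrow> 0) at_top"
  proof (rule tendsto_zero_of_dissipation)
    fix t assume t: "t \<ge> T"
    show "((\<lambda>t. (\<theta> t)\<^sup>2) has_real_derivative 2 * \<theta> t * (- \<gamma> * (m t * \<theta> t + r t))) (at t within {T..})"
      by (rule derivative_eq_intros der t refl | simp)+
    (* Young's inequality for the cross term, in the form of a completed square. *)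
    have "0 \<le> (l * \<theta> t + r t)\<^sup>2" by simp
    then have "0 \<le> l * (l * (\<theta> t)\<^sup>2 + 2 * \<theta> t * r t + (r t)\<^sup>2 / l)"
      using \<open>l > 0\<close> by (simp add: power2_sum power2_eq_square algebra_simps)
    then have "0 \<le> l * (\<theta> t)\<^sup>2 + 2 * \<theta> t * r t + (r t)\<^sup>2 / l"
      using \<open>l > 0\<close> by (simp add: zero_le_mult_iff)
    moreover have "l * (\<theta> t)\<^sup>2 \<le> m t * (\<theta> t)\<^sup>2"
      using m[OF t] by (simp add: mult_right_mono)
    ultimately have "l * (\<theta> t)\<^sup>2 - (r t)\<^sup>2 / l \<le> 2 * m t * (\<theta> t)\<^sup>2 + 2 * \<theta> t * r t"
      by linarith
    then have "\<gamma> * (l * (\<theta> t)\<^sup>2 - (r t)\<^sup>2 / l) \<le> \<gamma> * (2 * m t * (\<theta> t)\<^sup>2 + 2 * \<theta> t * r t)"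
      using \<open>\<gamma> > 0\<close> by simp
    then show "2 * \<theta> t * (- \<gamma> * (m t * \<theta> t + r t)) \<le> - (\<gamma> * l) * (\<theta> t)\<^sup>2 + \<gamma> * ((r t)\<^sup>2 / l)"
      by (simp add: algebra_simps power2_eq_square)
  next
    have "((\<lambda>t. \<gamma> * ((r t)\<^sup>2 / l)) \<longlongrightarrow> \<gamma> * (0\<^sup>2 / l)) at_top"
      using \<open>l > 0\<close> by (intro tendsto_intros r) auto
    then show "((\<lambda>t. \<gamma> * ((r t)\<^sup>2 / l)) \<longlongrightarrow> 0) at_top" by simp
  qed (use \<open>\<gamma> > 0\<close> \<open>l > 0\<close> in auto)
  then have "((\<lambda>t. sqrt ((\<theta> t)\<^sup>2)) \<longlongrightarrow> sqrt 0) at_top"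
    by (rule tendsto_real_sqrt)
  then show ?thesis by (simp add: tendsto_rabs_zero_iff)
qed

lemma Linf_time_of_continuous:
  assumes "continuous_on {0..} f" "\<And>t. t \<ge> 0 \<Longrightarrow> \<bar>f t\<bar> \<le> B"
  shows "Linf_time f"
  unfolding Linf_time_def bounded_iff
  using assms by (auto intro!: continuous_imp_measurable_on_sets_lebesgue)

lemma bounded_of_convergent:
  fixes f :: "real \<Rightarrow> real"
  assumes f: "continuous_on {0..} f" and L: "(f \<longlongrightarrow> L) at_top"
  obtains B where "\<And>t. t \<ge> 0 \<Longrightarrow> \<bar>f t\<bar> \<le> B"
proof -
  have "\<forall>\<^sub>F t in at_top. dist (f t) L < 1"
    using L by (rule tendstoD) simp
  then obtain S where S: "\<And>t. t \<ge> S \<Longrightarrow> dist (f t) L < 1"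
    by (auto simp: eventually_at_top_linorder)
  have "compact (f ` {0..S})"
    by (intro compact_continuous_image continuous_on_subset[OF f]) auto
  then obtain C where C: "\<And>t. t \<in> {0..S} \<Longrightarrow> \<bar>f t\<bar> \<le> C"
    using compact_imp_bounded by (force simp: bounded_iff)
  have "\<bar>f t\<bar> \<le> max C (\<bar>L\<bar> + 1)" if "t \<ge> 0" for t
    using S[of t] C[of t] that by (cases "t \<ge> S") (auto simp: dist_real_def)
  then show thesis by (rule that)
qed

text \<open>Monotone convergence along the intervals \<open>[0,n]\<close>.\<close>

lemma integrable_halfline_of_bounded_integrals:
  fixes P :: "real \<Rightarrow> real"
  assumes P: "continuous_on {0..} P" and pos: "\<And>t. t \<ge> 0 \<Longrightarrow> 0 \<le> P t"
    and B: "\<And>T. T \<ge> 0 \<Longrightarrow> integral {0..T} P \<le> B"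
  shows "integrable (lebesgue_on {0..}) P"
proof -
  have int: "P integrable_on {0..T}" for T
    by (intro integrable_continuous_real continuous_on_subset[OF P]) auto
  define f where "f = (\<lambda>n t. if t \<in> {0..real n} then P t else 0)"
  have fi: "f n integrable_on {0..}" and ie: "integral {0..} (f n) = integral {0..real n} P" for n
  proof -
    have "(P has_integral integral {0..real n} P) {0..real n}" using int by blast
    then have "(f n has_integral integral {0..real n} P) {0..}"
      unfolding f_def by (subst has_integral_restrict) auto
    then show "f n integrable_on {0..}" "integral {0..} (f n) = integral {0..real n} P"
      by (auto simp: integral_unique)
  qed
  have "P integrable_on {0..} \<and> (\<lambda>n. integral {0..} (f n)) \<longlonglongrightarrow> integral {0..} P"
  proof (rule monotone_convergence_increasing)
    show "f n integrable_on {0..}" for n by (rule fi)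
    show "f n t \<le> f (Suc n) t" if "t \<in> {0..}" for n t
      using pos that by (auto simp: f_def)
    show "(\<lambda>n. f n t) \<longlonglongrightarrow> P t" if "t \<in> {0..}" for t
    proof (rule tendsto_eventually)
      obtain N where "t \<le> real N" using real_arch_simple by blast
      then show "\<forall>\<^sub>F n in sequentially. f n t = P t"
        using that by (auto simp: f_def eventually_sequentially intro!: exI[of _ N])
    qed
    show "bounded (range (\<lambda>n. integral {0..} (f n)))"
    proof -
      have "norm (integral {0..} (f n)) \<le> B" for n
        using B[of "real n"] integral_nonneg[OF int, of "real n"] pos by (simp add: ie)
      then show ?thesis by (auto simp: bounded_iff)
    qed
  qed
  then have "P absolutely_integrable_on {0..}"
    using pos by (intro nonnegative_absolutely_integrable_1) auto
  then show ?thesis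
    by (simp add: integrable_restrict_space set_integrable_def)
qed

text \<open>Integrating the dissipation inequality over \<open>[0,T]\<close> gives
  \<open>\<theta>(T)\<^sup>2 + \<gamma> \<integral>\<^sub>0\<^sup>T P \<le> \<theta>(0)\<^sup>2 + \<gamma> C\<close>; each of the two nonnegative terms on the left is therefore
  bounded by the right hand side.\<close>

lemma normalized_gradient_estimator:
  fixes \<theta> P Q :: "real \<Rightarrow> real"
  assumes der: "has_time_derivative \<theta> \<theta>'"
    and P: "continuous_on {0..} P" "\<And>t. t \<ge> 0 \<Longrightarrow> 0 \<le> P t"
    and Q: "continuous_on {0..} Q" "\<And>T. T \<ge> 0 \<Longrightarrow> integral {0..T} Q \<le> C"
    and "\<gamma> > 0" and diss: "\<And>t. t \<ge> 0 \<Longrightarrow> 2 * \<theta> t * \<theta>' t \<le> - \<gamma> * P t + \<gamma> * Q t"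
  shows "\<And>t. t \<ge> 0 \<Longrightarrow> \<bar>\<theta> t\<bar> \<le> sqrt ((\<theta> 0)\<^sup>2 + \<gamma> * C)"
    and "integrable (lebesgue_on {0..}) P"
proof -
  have int: "P integrable_on {0..T}" "Q integrable_on {0..T}" for T
    by (rule integrable_continuous_real, rule continuous_on_subset[OF P(1)], simp,
        rule integrable_continuous_real, rule continuous_on_subset[OF Q(1)], simp)
  have energy: "(\<theta> T)\<^sup>2 + \<gamma> * integral {0..T} P \<le> (\<theta> 0)\<^sup>2 + \<gamma> * C" if "T \<ge> 0" for T
  proof -
    have "((\<lambda>t. 2 * \<theta> t * \<theta>' t) has_integral (\<theta> T)\<^sup>2 - (\<theta> 0)\<^sup>2) {0..T}"
    proof (rule fundamental_theorem_of_calculus[OF that, where f = "\<lambda>t. (\<theta> t)\<^sup>2"])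
      fix t assume t: "t \<in> {0..T}"
      have "(\<theta> has_real_derivative \<theta>' t) (at t within {0..T})"
        by (rule has_time_derivative_subset[OF der]) (use t in auto)
      then have "((\<lambda>t. (\<theta> t)\<^sup>2) has_real_derivative 2 * \<theta> t * \<theta>' t) (at t within {0..T})"
        by (auto intro!: derivative_eq_intros)
      then show "((\<lambda>t. (\<theta> t)\<^sup>2) has_vector_derivative 2 * \<theta> t * \<theta>' t) (at t within {0..T})"
        by (simp add: has_real_derivative_iff_has_vector_derivative)
    qed
    moreover have "((\<lambda>t. - \<gamma> * P t + \<gamma> * Q t) has_integral
        - \<gamma> * integral {0..T} P + \<gamma> * integral {0..T} Q) {0..T}"
      using int by (intro has_integral_add has_integral_mult_right integrable_integral)
    ultimately have "(\<theta> T)\<^sup>2 - (\<theta> 0)\<^sup>2 \<le> - \<gamma> * integral {0..T} P + \<gamma> * integral {0..T} Q"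
      by (rule has_integral_le) (use diss in auto)
    moreover have "\<gamma> * integral {0..T} Q \<le> \<gamma> * C"
      using Q(2)[OF that] \<open>\<gamma> > 0\<close> by simp
    ultimately show ?thesis by simp
  qed
  show "\<bar>\<theta> t\<bar> \<le> sqrt ((\<theta> 0)\<^sup>2 + \<gamma> * C)" if "t \<ge> 0" for t
  proof (rule real_le_rsqrt)
    have "0 \<le> integral {0..t} P"
      using P(2) int by (intro integral_nonneg) auto
    then have "0 \<le> \<gamma> * integral {0..t} P" using \<open>\<gamma> > 0\<close> by simp
    then show "\<bar>\<theta> t\<bar>\<^sup>2 \<le> (\<theta> 0)\<^sup>2 + \<gamma> * C"
      using energy[OF that] by simp
  qed
  show "integrable (lebesgue_on {0..}) P"
  proof (rule integrable_halfline_of_bounded_integrals[OF P])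
    fix T :: real assume T: "T \<ge> 0"
    have "\<gamma> * integral {0..T} P \<le> (\<theta> 0)\<^sup>2 + \<gamma> * C"
      using energy[OF T] by (smt (verit) zero_le_power2)
    then show "integral {0..T} P \<le> ((\<theta> 0)\<^sup>2 + \<gamma> * C) / \<gamma>"
      using \<open>\<gamma> > 0\<close> by (simp add: field_simps)
  qed
qed

section \<open>Test profiles and duality\<close>
text \<open>Profiles are defined on the whole line rather than on \<open>[0,1]\<close>, because they are evaluated at
  points \<open>x - b (T - t)\<close> to the right of it; vanishing on \<open>[1,\<infinity>)\<close> is what makes the translates vanish at the
  outflow boundary for all earlier times.\<close>

definition outflow_profile :: "(real \<Rightarrow> real) \<Rightarrow> bool" where
  "outflow_profile \<psi> \<longleftrightarrow>
     (\<exists>\<psi>'. (\<forall>x. (\<psi> has_real_derivative \<psi>' x) (at x)) \<and> continuous_on UNIV \<psi>') \<and> (\<forall>x\<ge>1. \<psi> x = 0)"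

lemma outflow_profile_continuous: "outflow_profile \<psi> \<Longrightarrow> continuous_on S \<psi>"
  unfolding outflow_profile_def
  by (meson DERIV_isCont continuous_at_imp_continuous_on)

lemma DERIV_positive_part_square:
  "((\<lambda>y::real. (max 0 y)\<^sup>2) has_real_derivative 2 * max 0 y) (at y)"
proof -
  consider "y > 0" | "y < 0" | "y = 0" by linarith
  then show ?thesis
  proof cases
    case 1
    have "((\<lambda>y::real. y\<^sup>2) has_real_derivative 2 * max 0 y) (at y)"
      using 1 by (auto intro!: derivative_eq_intros)
    moreover have "\<forall>\<^sub>F z in nhds y. (max 0 z)\<^sup>2 = z\<^sup>2"
      using 1 by (intro eventually_mono[OF eventually_nhds_in_open[of "{0<..}" y]]) auto
    ultimately show ?thesis by (subst DERIV_cong_ev[OF refl _ refl])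
  next
    case 2
    have "((\<lambda>y::real. 0) has_real_derivative 2 * max 0 y) (at y)"
      using 2 by (auto intro!: derivative_eq_intros)
    moreover have "\<forall>\<^sub>F z in nhds y. (max 0 z)\<^sup>2 = 0"
      using 2 by (intro eventually_mono[OF eventually_nhds_in_open[of "{..<0}" y]]) auto
    ultimately show ?thesis by (subst DERIV_cong_ev[OF refl _ refl])
  next
    case 3
    have "((\<lambda>h::real. (max 0 h)\<^sup>2 / h) \<longlongrightarrow> 0) (at 0)"
    proof (rule tendsto_rabs_zero_cancel, rule tendsto_sandwich[where f = "\<lambda>_. 0"])
      have le: "\<bar>(max 0 h)\<^sup>2 / h\<bar> \<le> \<bar>h\<bar>" for h :: real
        by (cases "h > 0") (auto simp: power2_eq_square)
      show "\<forall>\<^sub>F h::real in at 0. \<bar>(max 0 h)\<^sup>2 / h\<bar> \<le> \<bar>h\<bar>"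
        by (rule always_eventually, rule allI, rule le)
      show "((\<lambda>h::real. \<bar>h\<bar>) \<longlongrightarrow> 0) (at 0)"
        by (rule tendsto_rabs_zero) (rule tendsto_ident_at)
    qed auto
    then show ?thesis using 3 by (simp add: DERIV_def)
  qed
qed

text \<open>The square of the positive part is continuously differentiable, so multiplying by it cuts a
  smooth function off without losing regularity.\<close>

lemma outflow_profile_cutoff:
  assumes p: "\<And>x. (p has_real_derivative p' x) (at x)" "continuous_on UNIV p'"
    and q: "\<And>x. (q has_real_derivative q' x) (at x)" "continuous_on UNIV q'"
    and q1: "\<And>x. x \<ge> 1 \<Longrightarrow> q x \<le> 0"
  shows "outflow_profile (\<lambda>x. p x * (max 0 (q x))\<^sup>2)"
  unfolding outflow_profile_def
proof (intro conjI exI allI impI)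
  let ?d = "\<lambda>x. p' x * (max 0 (q x))\<^sup>2 + (2 * max 0 (q x) * q' x) * p x"
  show "((\<lambda>x. p x * (max 0 (q x))\<^sup>2) has_real_derivative ?d x) (at x)" for x
    by (rule DERIV_mult[OF p(1) DERIV_chain2[OF DERIV_positive_part_square q(1)]])
  have "continuous_on UNIV p" "continuous_on UNIV q"
    using p(1) q(1) by (meson DERIV_isCont continuous_at_imp_continuous_on)+
  then show "continuous_on UNIV ?d"
    by (intro continuous_intros p(2) q(2))
  show "p x * (max 0 (q x))\<^sup>2 = 0" if "x \<ge> 1" for x
    using q1[OF that] by simp
qed

text \<open>Measurable functions are limits almost everywhere of continuous functions. Truncation at level
  \<open>M\<close> keeps the approximants bounded, polynomials make them smooth, and the cutoff
  \<open>(1 - x\<^sup>n)\<^sup>2\<close>, which tends to \<open>1\<close> on \<open>[0,1)\<close>, makes them vanish from \<open>1\<close> on. Uniform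
  boundedness is what dominated convergence will ask for.\<close>

lemma clamp_approximation:
  fixes w :: "real \<Rightarrow> real"
  assumes "w \<in> borel_measurable (lebesgue_on {0..1})" "M > 0"
  obtains \<psi> where "\<And>n. outflow_profile (\<psi> n)"
    "\<And>n x. x \<in> {0..1} \<Longrightarrow> \<bar>\<psi> n x\<bar> \<le> M + 1"
    "AE x in lebesgue_on {0..1}. (\<lambda>n. \<psi> n x) \<longlonglongrightarrow> max (-M) (min M (w x))"
proof -
  have "w measurable_on {0..1}"
    using assms(1) by (subst measurable_on_iff_borel_measurable) auto
  then obtain N g where N: "negligible N" and g: "\<And>n. continuous_on UNIV (g n)"
    and lim: "\<And>x. x \<notin> N \<Longrightarrow> (\<lambda>n. g n x) \<longlonglongrightarrow> (if x \<in> {0..1} then w x else 0)"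
    unfolding measurable_on_def by metis
  define k where "k = (\<lambda>n x. max (-M) (min M (g n x)))"
  have k: "continuous_on {0..1} (k n)" for n
    unfolding k_def by (intro continuous_intros continuous_on_subset[OF g]) auto
  have "\<exists>p. real_polynomial_function p \<and> (\<forall>x\<in>{0..1}. \<bar>k n x - p x\<bar> < 1 / real (Suc n))" for n
    by (rule Stone_Weierstrass_real_polynomial_function[OF compact_Icc k, of "1 / real (Suc n)"])
      (simp, blast)
  then obtain p where p: "\<And>n. real_polynomial_function (p n)"
      "\<And>n x. x \<in> {0..1} \<Longrightarrow> \<bar>k n x - p n x\<bar> < 1 / real (Suc n)"
    by metis
  define \<psi> where "\<psi> = (\<lambda>n x. p n x * (max 0 (1 - x ^ Suc n))\<^sup>2)"
  show thesis
  proof (rule that[of \<psi>])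
    fix n
    obtain p' where p': "real_polynomial_function p'" "\<And>x. (p n has_real_derivative p' x) (at x)"
      using has_real_derivative_polynomial_function[OF p(1)] by blast
    have "continuous_on UNIV p'"
      using p'(1) by (simp add: continuous_on_polymonial_function real_polynomial_function_eq)
    then show "outflow_profile (\<psi> n)"
      unfolding \<psi>_def
    proof (rule outflow_profile_cutoff[OF p'(2)])
      show "((\<lambda>x. 1 - x ^ Suc n) has_real_derivative - (real (Suc n) * x ^ n)) (at x)" for x :: real
        by (rule derivative_eq_intros refl | simp)+
      show "1 - x ^ Suc n \<le> 0" if "x \<ge> 1" for x :: real
        using one_le_power[OF that, of "Suc n"] by simp
    qed (intro continuous_intros)
  next
    fix n and x :: real assume x: "x \<in> {0..1}"
    have "\<bar>k n x\<bar> \<le> M" using \<open>M > 0\<close> by (auto simp: k_def)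
    moreover have "1 / real (Suc n) \<le> 1" by simp
    ultimately have "\<bar>p n x\<bar> \<le> M + 1" using p(2)[OF x, of n] by linarith
    moreover have "0 \<le> 1 - x ^ Suc n" "1 - x ^ Suc n \<le> 1"
      using x by (auto intro!: power_le_one mult_le_one)
    then have "(max 0 (1 - x ^ Suc n))\<^sup>2 \<le> 1"
      by (simp add: power_le_one)
    ultimately show "\<bar>\<psi> n x\<bar> \<le> M + 1"
      using mult_mono[of "\<bar>p n x\<bar>" "M + 1" "(max 0 (1 - x ^ Suc n))\<^sup>2" 1] \<open>M > 0\<close>
      by (simp add: \<psi>_def abs_mult)
  next
    have "insert 1 N \<in> null_sets lebesgue"
      using N by (simp only: negligible_iff_null_sets[symmetric] negligible_insert)
    then have "AE x in lebesgue. x \<notin> insert 1 N"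
      by (rule AE_not_in)
    then have "AE x in lebesgue. x \<in> {0..1} \<longrightarrow> x \<notin> insert 1 N"
      by eventually_elim simp
    then have "AE x in lebesgue_on {0..1}. x \<notin> insert 1 N"
      by (subst AE_restrict_space_iff) auto
    then show "AE x in lebesgue_on {0..1}. (\<lambda>n. \<psi> n x) \<longlonglongrightarrow> max (-M) (min M (w x))"
      using AE_space
    proof eventually_elim
      case (elim x)
      then have x: "x \<in> {0..1}" "x < 1" "x \<notin> N" by auto
      have "(\<lambda>n. k n x) \<longlonglongrightarrow> max (-M) (min M (w x))"
        unfolding k_def using lim[OF x(3)] x(1) by (intro tendsto_intros) auto
      moreover have "(\<lambda>n. p n x - k n x) \<longlonglongrightarrow> 0"
      proof (rule Lim_null_comparison)
        show "\<forall>\<^sub>F n in sequentially. norm (p n x - k n x) \<le> inverse (real (Suc n))"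
        proof (rule always_eventually, rule allI)
          show "norm (p n x - k n x) \<le> inverse (real (Suc n))" for n
            using p(2)[OF x(1), of n] by (simp add: abs_minus_commute inverse_eq_divide)
        qed
        show "(\<lambda>n. inverse (real (Suc n))) \<longlonglongrightarrow> 0" by (rule LIMSEQ_inverse_real_of_nat)
      qed
      ultimately have "(\<lambda>n. k n x + (p n x - k n x)) \<longlonglongrightarrow> max (-M) (min M (w x)) + 0"
        by (intro tendsto_add)
      then have 1: "(\<lambda>n. p n x) \<longlonglongrightarrow> max (-M) (min M (w x))" by simp
      have "(\<lambda>n. x ^ Suc n) \<longlonglongrightarrow> 0"
        using x by (intro LIMSEQ_Suc LIMSEQ_realpow_zero) auto
      then have "(\<lambda>n. p n x * (max 0 (1 - x ^ Suc n))\<^sup>2) \<longlonglongrightarrow> max (-M) (min M (w x)) * (max 0 (1 - 0))\<^sup>2"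
        by (intro tendsto_intros 1)
      then show ?case by (simp add: \<psi>_def)
    qed
  qed
qed

text \<open>The truncation \<open>v\<close> of \<open>w\<close> at level \<open>M\<close> is a bounded limit of profiles, so the hypothesis passes
  to \<open>\<psi> = v\<close>. As \<open>v\<^sup>2 \<le> w v\<close>, this gives \<open>\<parallel>v\<parallel>\<^sup>2 \<le> K \<parallel>v\<parallel>\<close>; finally \<open>M\<close> tends to infinity. Testing
  against truncations avoids approximating \<open>w\<close> itself in norm.\<close>

lemma L2_norm_le_by_duality:
  assumes w: "L2_on {0..1} w" and "K \<ge> 0"
    and dual: "\<And>\<psi>. outflow_profile \<psi> \<Longrightarrow> \<bar>LINT x|lebesgue_on {0..1}. w x * \<psi> x\<bar> \<le> K * L2_norm \<psi>"
  shows "L2_norm w \<le> K"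
proof -
  let ?L = "lebesgue_on {0..1::real}"
  have wm[measurable]: "w \<in> borel_measurable ?L" and w2: "integrable ?L (\<lambda>x. (w x)\<^sup>2)"
    using w by (auto simp: L2_on_def)
  have one: "L2_on {0..1} (\<lambda>x. 1)"
    by (auto simp: L2_on_def intro!: continuous_imp_integrable_real)
  have w1: "integrable ?L w"
    using L2_on_mult_integrable[OF w one] by simp
  define v where "v = (\<lambda>M x. max (-M) (min M (w x)))"
  have vm[measurable]: "v M \<in> borel_measurable ?L" for M
    unfolding v_def by measurable
  have vb: "\<bar>v M x\<bar> \<le> M" if "M > 0" for M x using that by (auto simp: v_def)
  have clamp: "L2_norm (v M) \<le> K" if M: "M > 0" for M
  proof -
    obtain \<psi> where \<psi>: "\<And>n. outflow_profile (\<psi> n)"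
      and b: "\<And>n x. x \<in> {0..1} \<Longrightarrow> \<bar>\<psi> n x\<bar> \<le> M + 1"
      and lim: "AE x in ?L. (\<lambda>n. \<psi> n x) \<longlonglongrightarrow> v M x"
      using clamp_approximation[OF wm M] unfolding v_def by metis
    have \<psi>m[measurable]: "\<psi> n \<in> borel_measurable ?L" for n
      by (intro continuous_imp_measurable_on_sets_lebesgue outflow_profile_continuous \<psi>) auto
    have 1: "(\<lambda>n. LINT x|?L. w x * \<psi> n x) \<longlonglongrightarrow> (LINT x|?L. w x * v M x)"
    proof (rule integral_dominated_convergence[where w = "\<lambda>x. (M + 1) * \<bar>w x\<bar>"])
      show "integrable ?L (\<lambda>x. (M + 1) * \<bar>w x\<bar>)" using w1 by simp
      show "AE x in ?L. (\<lambda>n. w x * \<psi> n x) \<longlonglongrightarrow> w x * v M x"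
        using lim by eventually_elim (intro tendsto_intros)
      show "AE x in ?L. norm (w x * \<psi> n x) \<le> (M + 1) * \<bar>w x\<bar>" for n
      proof (rule AE_I2)
        fix x assume "x \<in> space ?L"
        then show "norm (w x * \<psi> n x) \<le> (M + 1) * \<bar>w x\<bar>"
          using mult_right_mono[OF b[of x n], of "\<bar>w x\<bar>"] by (simp add: abs_mult mult.commute)
      qed
    qed measurable
    have 2: "(\<lambda>n. LINT x|?L. (\<psi> n x)\<^sup>2) \<longlonglongrightarrow> (LINT x|?L. (v M x)\<^sup>2)"
    proof (rule integral_dominated_convergence[where w = "\<lambda>x. (M + 1)\<^sup>2"])
      show "integrable ?L (\<lambda>x. (M + 1)\<^sup>2)" by (intro continuous_imp_integrable_real) auto
      show "AE x in ?L. (\<lambda>n. (\<psi> n x)\<^sup>2) \<longlonglongrightarrow> (v M x)\<^sup>2"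
        using lim by eventually_elim (intro tendsto_intros)
      show "AE x in ?L. norm ((\<psi> n x)\<^sup>2) \<le> (M + 1)\<^sup>2" for n
      proof (rule AE_I2)
        fix x assume "x \<in> space ?L"
        then show "norm ((\<psi> n x)\<^sup>2) \<le> (M + 1)\<^sup>2"
          using b[of x n] M abs_le_square_iff[of "\<psi> n x" "M + 1"] by simp
      qed
    qed measurable
    have "\<bar>LINT x|?L. w x * v M x\<bar> \<le> K * L2_norm (v M)"
    proof (rule LIMSEQ_le)
      show "(\<lambda>n. \<bar>LINT x|?L. w x * \<psi> n x\<bar>) \<longlonglongrightarrow> \<bar>LINT x|?L. w x * v M x\<bar>"
        using 1 by (rule tendsto_rabs)
      show "(\<lambda>n. K * L2_norm (\<psi> n)) \<longlonglongrightarrow> K * L2_norm (v M)"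
        unfolding L2_norm_def using 2 by (intro tendsto_intros)
    qed (use dual[OF \<psi>] in auto)
    moreover have "(L2_norm (v M))\<^sup>2 \<le> (LINT x|?L. w x * v M x)"
      unfolding L2_norm_square
    proof (rule integral_mono)
      have M2: "integrable ?L (\<lambda>x. M\<^sup>2)" by (intro continuous_imp_integrable_real) auto
      show "integrable ?L (\<lambda>x. (v M x)\<^sup>2)"
      proof (rule Bochner_Integration.integrable_bound[OF M2])
        have "norm ((v M x)\<^sup>2) \<le> norm (M\<^sup>2)" for x
          using vb[OF M, of x] M abs_le_square_iff[of "v M x" M] by simp
        then show "AE x in ?L. norm ((v M x)\<^sup>2) \<le> norm (M\<^sup>2)"
          by (rule AE_I2)
      qed measurable
      show "integrable ?L (\<lambda>x. w x * v M x)"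
      proof (rule Bochner_Integration.integrable_bound)
        show "integrable ?L (\<lambda>x. M * w x)" using w1 by simp
        have "norm (w x * v M x) \<le> norm (M * w x)" for x
          using mult_right_mono[OF vb[OF M], of "\<bar>w x\<bar>" x] M by (simp add: abs_mult mult.commute)
        then show "AE x in ?L. norm (w x * v M x) \<le> norm (M * w x)"
          by (rule AE_I2)
      qed measurable
      show "(v M x)\<^sup>2 \<le> w x * v M x" for x
      proof -
        consider "w x > M" | "w x < - M" | "\<bar>w x\<bar> \<le> M" by linarith
        then show ?thesis
        proof cases
          case 1
          then have "v M x = M" using M by (simp add: v_def)
          then show ?thesis using 1 M by (simp add: power2_eq_square)
        next
          case 2
          then have "v M x = - M" using M by (simp add: v_def)
          then show ?thesis using mult_right_mono[of M "- w x" M] 2 M by (simp add: power2_eq_square)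
        next
          case 3
          then have "v M x = w x" by (simp add: v_def)
          then show ?thesis by (simp add: power2_eq_square)
        qed
      qed
    qed
    ultimately have "L2_norm (v M) * L2_norm (v M) \<le> K * L2_norm (v M)"
      by (simp add: power2_eq_square)
    then show ?thesis
      using \<open>K \<ge> 0\<close> L2_norm_nonneg[of "v M"]
      by (cases "L2_norm (v M) = 0") (simp, simp add: mult_le_cancel_right)
  qed
  have "(\<lambda>n. LINT x|?L. (v (real (Suc n)) x)\<^sup>2) \<longlonglongrightarrow> (LINT x|?L. (w x)\<^sup>2)"
  proof (rule integral_dominated_convergence[where w = "\<lambda>x. (w x)\<^sup>2"])
    show "AE x in ?L. (\<lambda>n. (v (real (Suc n)) x)\<^sup>2) \<longlonglongrightarrow> (w x)\<^sup>2"
    proof (intro AE_I2 tendsto_eventually)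
      fix x
      obtain N where "\<bar>w x\<bar> \<le> real N" using real_arch_simple by blast
      then show "\<forall>\<^sub>F n in sequentially. (v (real (Suc n)) x)\<^sup>2 = (w x)\<^sup>2"
        unfolding eventually_sequentially by (intro exI[of _ N]) (auto simp: v_def)
    qed
    have "\<bar>v M x\<bar> \<le> \<bar>w x\<bar>" if "M > 0" for M x
      using that by (auto simp: v_def max_def min_def)
    then have "(v M x)\<^sup>2 \<le> (w x)\<^sup>2" if "M > 0" for M x
      using that by (simp add: abs_le_square_iff)
    then show "AE x in ?L. norm ((v (real (Suc n)) x)\<^sup>2) \<le> (w x)\<^sup>2" for n
      by simp
    show "integrable ?L (\<lambda>x. (w x)\<^sup>2)" by (rule w2)
  qed measurable
  then have "(\<lambda>n. L2_norm (v (real (Suc n)))) \<longlonglongrightarrow> L2_norm w"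
    unfolding L2_norm_def by (rule tendsto_real_sqrt)
  then show ?thesis
    using clamp by (intro LIMSEQ_le_const2) auto
qed

section \<open>Mild form of the transport equation\<close>
text \<open>The integral over \<open>[0,1]\<close> of the translated profile: the weight with which a spatially constant source
  at time \<open>t\<close> contributes to the pairing at time \<open>T\<close>.\<close>

definition mild_source :: "real \<Rightarrow> (real \<Rightarrow> real) \<Rightarrow> real \<Rightarrow> real \<Rightarrow> real" where
  "mild_source b \<psi> T t = (LINT x|lebesgue_on {0..1}. \<psi> (x - b * (T - t)))"

text \<open>Duhamel's formula, paired with a profile \<open>\<psi>\<close>. Stating it in this dual form avoids an
  explicit solution formula by characteristics for data that are only square integrable or bounded.\<close>

definition mild_transport_solution ::
  "real \<Rightarrow> (real \<Rightarrow> real) \<Rightarrow> (real \<Rightarrow> real) \<Rightarrow> (real \<Rightarrow> real \<Rightarrow> real) \<Rightarrow> bool" where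
  "mild_transport_solution b f g w \<longleftrightarrow>
     (\<forall>t\<ge>0. L2_on {0..1} (\<lambda>x. w x t)) \<and>
     (\<forall>\<psi> T. outflow_profile \<psi> \<longrightarrow> T > 0 \<longrightarrow>
        (LINT x|lebesgue_on {0..1}. w x T * \<psi> x) =
        (LINT x|lebesgue_on {0..1}. w x 0 * \<psi> (x - b * T)) +
        (LINT t|lebesgue_on {0..T}. f t * mild_source b \<psi> T t - b * g t * \<psi> (- b * (T - t))))"

lemma transport_solution_imp_curve: "transport_solution b f g w \<Longrightarrow> L2_curve w"
  unfolding transport_solution_def L2_curve_def by blast

text \<open>Translates of a profile along the characteristics solve the dual equation: the \<open>t\<close>-derivative is
  \<open>b\<close> times the \<open>x\<close>-derivative, so that the term of the weak identity that contains \<open>w\<close> inside the time integral drops out.\<close>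

lemma C1_on_rectangle_characteristics:
  assumes \<psi>: "\<And>x. (\<psi> has_real_derivative \<psi>' x) (at x)" and c: "continuous_on UNIV \<psi>'"
  shows "C1_on_rectangle T (\<lambda>x t. \<psi> (x - b * (T - t))) (\<lambda>x t. \<psi>' (x - b * (T - t)))
    (\<lambda>x t. b * \<psi>' (x - b * (T - t)))"
  unfolding C1_on_rectangle_def
proof (intro conjI ballI)
  fix x t :: real
  have "((\<lambda>y. y - b * (T - t)) has_real_derivative 1) (at x within {0..1})"
    by (auto intro!: derivative_eq_intros)
  from DERIV_chain2[OF \<psi> this]
  show "((\<lambda>y. \<psi> (y - b * (T - t))) has_real_derivative \<psi>' (x - b * (T - t))) (at x within {0..1})"
    by simp
  have "((\<lambda>s. x - b * (T - s)) has_real_derivative b) (at t within {0..T})"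
    by (auto intro!: derivative_eq_intros)
  from DERIV_chain2[OF \<psi> this]
  show "((\<lambda>s. \<psi> (x - b * (T - s))) has_real_derivative b * \<psi>' (x - b * (T - t))) (at t within {0..T})"
    by (simp add: mult.commute)
next
  have *: "continuous_on ({0..1} \<times> {0..T}) (\<lambda>z. \<psi>' (fst z - b * (T - snd z)))"
    by (rule continuous_on_compose2[OF c]) (auto intro!: continuous_intros)
  then show "continuous_on ({0..1} \<times> {0..T}) (\<lambda>(x, t). \<psi>' (x - b * (T - t)))"
    by (simp add: case_prod_unfold)
  show "continuous_on ({0..1} \<times> {0..T}) (\<lambda>(x, t). b * \<psi>' (x - b * (T - t)))"
    unfolding case_prod_unfold by (intro continuous_intros *)
qed

lemma transport_solution_imp_mild:
  assumes "transport_solution b f g w" "b < 0"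
  shows "mild_transport_solution b f g w"
  unfolding mild_transport_solution_def
proof (intro conjI allI impI)
  show "L2_on {0..1} (\<lambda>x. w x t)" if "t \<ge> 0" for t
    using assms that by (simp add: transport_solution_def)
  fix \<psi> and T :: real
  assume "outflow_profile \<psi>" and T: "T > 0"
  then obtain \<psi>' where \<psi>: "\<And>x. (\<psi> has_real_derivative \<psi>' x) (at x)" "continuous_on UNIV \<psi>'"
    and out: "\<And>x. x \<ge> 1 \<Longrightarrow> \<psi> x = 0"
    unfolding outflow_profile_def by blast
  let ?\<phi> = "\<lambda>x t. \<psi> (x - b * (T - t))" and ?\<phi>' = "\<lambda>x t. \<psi>' (x - b * (T - t))"
  have "?\<phi> 1 t = 0" if "t \<in> {0..T}" for t
    using that \<open>b < 0\<close> by (intro out) (simp add: mult_nonpos_nonneg)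
  then have "(LINT x|lebesgue_on {0..1}. w x T * ?\<phi> x T) - (LINT x|lebesgue_on {0..1}. w x 0 * ?\<phi> x 0) =
        (LINT t|lebesgue_on {0..T}.
           (LINT x|lebesgue_on {0..1}. w x t * (b * ?\<phi>' x t - b * ?\<phi>' x t))
           + f t * (LINT x|lebesgue_on {0..1}. ?\<phi> x t)
           - b * g t * ?\<phi> 0 t)"
    using assms(1) T C1_on_rectangle_characteristics[OF \<psi>, of T b]
    unfolding transport_solution_def by blast
  then show "(LINT x|lebesgue_on {0..1}. w x T * \<psi> x) =
        (LINT x|lebesgue_on {0..1}. w x 0 * \<psi> (x - b * T)) +
        (LINT t|lebesgue_on {0..T}. f t * mild_source b \<psi> T t - b * g t * \<psi> (- b * (T - t)))"
    by (simp add: mild_source_def)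
qed

lemma mild_source_eq_integral:
  assumes "outflow_profile \<psi>"
  shows "mild_source b \<psi> T t = integral {0..1} (\<lambda>x. \<psi> (x - b * (T - t)))"
  unfolding mild_source_def
  by (intro lebesgue_integral_eq_integral continuous_imp_integrable_real
      continuous_on_compose2[OF outflow_profile_continuous[OF assms, of UNIV]] continuous_intros) auto

lemma mild_source_continuous:
  assumes "outflow_profile \<psi>"
  shows "continuous_on S (mild_source b \<psi> T)"
proof -
  have "continuous_on (S \<times> cbox 0 1) (\<lambda>(t, x). \<psi> (x - b * (T - t)))"
    unfolding case_prod_unfold
    by (intro continuous_on_compose2[OF outflow_profile_continuous[OF assms, of UNIV]] continuous_intros) auto
  then have "continuous_on S (\<lambda>t. integral (cbox 0 1) (\<lambda>x. \<psi> (x - b * (T - t))))"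
    by (rule integral_continuous_on_param)
  then show ?thesis
    by (simp add: mild_source_eq_integral[OF assms] cong: continuous_on_cong)
qed

lemma outflow_profile_L2_on: "outflow_profile \<psi> \<Longrightarrow> L2_on {0..1} (\<lambda>x. \<psi> (x + s))"
  unfolding L2_on_def
  by (intro conjI continuous_imp_measurable_on_sets_lebesgue continuous_imp_integrable_real
      continuous_intros continuous_on_compose2[OF outflow_profile_continuous[of \<psi> UNIV]]) auto

text \<open>Translating a nonnegative function to the left moves mass out of \<open>[0,1]\<close>, and none enters from
  the right, where the function is zero.\<close>

lemma integral_shift_le:
  fixes h :: "real \<Rightarrow> real"
  assumes h: "continuous_on UNIV h" and pos: "\<And>x. 0 \<le> h x" and zero: "\<And>x. x \<ge> 1 \<Longrightarrow> h x = 0"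
    and s: "s \<ge> 0"
  shows "(LINT x|lebesgue_on {0..1}. h (x + s)) \<le> (LINT x|lebesgue_on {0..1}. h x)"
proof -
  have c: "continuous_on A h" for A using h continuous_on_subset by blast
  have int: "h integrable_on {p..q}" for p q by (intro integrable_continuous_real c)
  have eq: "(LINT x|lebesgue_on {0..1}. h (x + r)) = integral {r..r + 1} h" for r
  proof -
    have "(LINT x|lebesgue_on {0..1}. h (x + r)) = integral {0..1} (\<lambda>x. h (x + r))"
      by (intro lebesgue_integral_eq_integral continuous_imp_integrable_real
          continuous_on_compose2[OF h] continuous_intros) auto
    also have "\<dots> = integral {r..r + 1} h"
      using integral_shift_real_ivl[of r r "r + 1" h] by simp
    finally show ?thesis .
  qed
  have "integral {s..s + 1} h \<le> integral {0..s + 1} h"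
    using s pos by (intro integral_subset_le int) auto
  also have "\<dots> = integral {0..1} h + integral {1..s + 1} h"
    using s by (intro Henstock_Kurzweil_Integration.integral_combine[symmetric] int) auto
  also have "integral {1..s + 1} h = 0"
    by (intro integral_unique has_integral_is_0) (auto simp: zero)
  finally show ?thesis using eq[of s] eq[of 0] by simp
qed

section \<open>Norm bounds, extinction and excitation for the transport equation\<close>
text \<open>If \<open>q\<close> is not integrable, its integral is \<open>0\<close> by convention and the bound holds trivially. So the
  source and the inflow enter the norm bound below only through pointwise bounds.\<close>

lemma abs_integral_le_dominating:
  fixes q k :: "'a::euclidean_space \<Rightarrow> real"
  assumes "integrable M k" "\<And>x. x \<in> space M \<Longrightarrow> \<bar>q x\<bar> \<le> k x"
  shows "\<bar>integral\<^sup>L M q\<bar> \<le> integral\<^sup>L M k"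
proof (cases "integrable M q")
  case True
  then show ?thesis
    using Bochner_Integration.integral_norm_bound_integral[OF True assms(1)] assms(2) by simp
next
  case False
  moreover have "0 \<le> integral\<^sup>L M k"
    by (rule Bochner_Integration.integral_nonneg) (use assms(2) in force)
  ultimately show ?thesis by (simp add: not_integrable_integral_eq)
qed

text \<open>The indicator marks the times in \<open>[0,T]\<close> that are within distance \<open>r\<close> of the final time.\<close>

lemma integral_tail_window:
  fixes T r :: real
  assumes "r \<ge> 0"
  shows "integrable (lebesgue_on {0..T}) (indicator {T - r..} :: real \<Rightarrow> real)"
    and "(LINT t|lebesgue_on {0..T}. indicator {T - r..} t) \<le> r"
    and "r \<le> T \<Longrightarrow> (LINT t|lebesgue_on {0..T}. indicator {T - r..} t) = r"
proof -
  have *: "{T - r..} \<inter> {0..T} = {max 0 (T - r)..T}" by auto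
  have e: "(LINT t|lebesgue_on {0..T}. indicator {T - r..} t) = measure lebesgue {max 0 (T - r)..T}"
    using * by (simp add: measure_restrict_space del: Int_atLeastAtMost Int_atLeastAtMostR1 Int_atLeastAtMostR2)
  show "(LINT t|lebesgue_on {0..T}. indicator {T - r..} t) \<le> r"
    using assms unfolding e by (cases "max 0 (T - r) \<le> T") auto
  show "(LINT t|lebesgue_on {0..T}. indicator {T - r..} t) = r" if "r \<le> T"
    using assms that unfolding e by simp
  have "integrable (lebesgue_on {0..T}) (\<lambda>x. 1::real)"
    by (intro continuous_imp_integrable_real continuous_intros)
  then show "integrable (lebesgue_on {0..T}) (indicator {T - r..} :: real \<Rightarrow> real)"
    by (rule Bochner_Integration.integrable_bound)
      (auto simp: indicator_def sets_restrict_space_iff intro!: borel_measurable_indicator')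
qed

lemma outflow_profile_abs_integral_le:
  assumes "outflow_profile \<psi>"
  shows "(LINT x|lebesgue_on {0..1}. \<bar>\<psi> x\<bar>) \<le> L2_norm \<psi>"
proof -
  have abs: "L2_on {0..1} (\<lambda>x. \<bar>\<psi> x\<bar>)" and one: "L2_on {0..1} (\<lambda>x. 1)"
    unfolding L2_on_def using outflow_profile_continuous[OF assms]
    by (intro conjI continuous_imp_measurable_on_sets_lebesgue continuous_imp_integrable_real continuous_intros; simp)+
  show ?thesis
    using L2_Cauchy_Schwarz[OF abs one] by (simp add: L2_norm_def measure_restrict_space)
qed

text \<open>What enters the interval more than the transit time \<open>-1/b\<close> before \<open>T\<close> has left it by \<open>T\<close>.\<close>

lemma mild_source_bound:
  assumes \<psi>: "outflow_profile \<psi>" and "b < 0" "t \<le> T"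
  shows "\<bar>mild_source b \<psi> T t\<bar> \<le> (LINT x|lebesgue_on {0..1}. \<bar>\<psi> x\<bar>) * indicator {T - (- 1 / b)..} t"
proof (cases "t \<ge> T - (- 1 / b)")
  case True
  have out: "\<And>x. x \<ge> 1 \<Longrightarrow> \<psi> x = 0" using \<psi> by (simp add: outflow_profile_def)
  have "\<bar>mild_source b \<psi> T t\<bar> \<le> (LINT x|lebesgue_on {0..1}. \<bar>\<psi> (x + - b * (T - t))\<bar>)"
    unfolding mild_source_def using integral_abs_bound by (simp add: algebra_simps)
  also have "\<dots> \<le> (LINT x|lebesgue_on {0..1}. \<bar>\<psi> x\<bar>)"
    using assms out outflow_profile_continuous[OF \<psi>]
    by (intro integral_shift_le continuous_intros) (auto simp: mult_nonpos_nonneg)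
  finally show ?thesis using True by simp
next
  case False
  then have "- b * (T - t) \<ge> 1" using \<open>b < 0\<close> by (simp add: field_simps)
  then have "\<psi> (x - b * (T - t)) = 0" if "x \<ge> 0" for x
    using \<psi> that by (simp add: outflow_profile_def)
  then have "mild_source b \<psi> T t = (LINT x|lebesgue_on {0..1::real}. 0)"
    unfolding mild_source_def by (intro Bochner_Integration.integral_cong) auto
  then show ?thesis by simp
qed

text \<open>Substituting \<open>y = -b (T - t)\<close> turns the time integral into a space integral over
  \<open>[0, -b T]\<close>, of which only the part in \<open>[0,1]\<close> counts.\<close>

lemma boundary_trace_integral:
  assumes \<psi>: "outflow_profile \<psi>" and "b < 0" "T \<ge> 0"
  shows "(LINT t|lebesgue_on {0..T}. - b * \<bar>\<psi> (- b * (T - t))\<bar>) \<le> (LINT x|lebesgue_on {0..1}. \<bar>\<psi> x\<bar>)"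
proof -
  have c: "continuous_on A (\<lambda>x. \<bar>\<psi> x\<bar>)" for A
    by (intro continuous_intros outflow_profile_continuous[OF \<psi>])
  have int: "(\<lambda>x. \<bar>\<psi> x\<bar>) integrable_on {p..q}" for p q by (intro integrable_continuous_real c)
  have out: "\<And>x. x \<ge> 1 \<Longrightarrow> \<psi> x = 0" using \<psi> by (simp add: outflow_profile_def)
  define S where "S = - b * T"
  have S: "S \<ge> 0" using assms by (simp add: S_def mult_nonpos_nonneg)
  have sub: "((\<lambda>t. b *\<^sub>R \<bar>\<psi> (- b * (T - t))\<bar>) has_integral
      integral {- b * (T - 0)..- b * (T - T)} (\<lambda>x. \<bar>\<psi> x\<bar>) - integral {- b * (T - T)..- b * (T - 0)} (\<lambda>x. \<bar>\<psi> x\<bar>)) {0..T}"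
  proof (rule has_integral_substitution_general[of "{}" 0 T _ 0 S])
    show "(\<lambda>t. - b * (T - t)) ` {0..T} \<subseteq> {0..S}"
    proof
      fix y assume "y \<in> (\<lambda>t. - b * (T - t)) ` {0..T}"
      then obtain t where t: "y = - b * (T - t)" "0 \<le> t" "t \<le> T" by (elim imageE) auto
      have "0 \<le> - b * (T - t)" "0 \<le> - b * t"
        using t \<open>b < 0\<close> by (intro mult_nonneg_nonneg; simp)+
      then show "y \<in> {0..S}" using t by (simp add: S_def algebra_simps)
    qed
    show "((\<lambda>t. - b * (T - t)) has_real_derivative b) (at x within {0..T})" for x
      by (auto intro!: derivative_eq_intros)
  qed (use assms in \<open>auto intro!: continuous_intros c\<close>)
  have "integral {- b * (T - 0)..- b * (T - T)} (\<lambda>x. \<bar>\<psi> x\<bar>) = 0"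
    using S by (cases "S = 0") (auto simp: S_def)
  with sub have "((\<lambda>t. - (b *\<^sub>R \<bar>\<psi> (- b * (T - t))\<bar>)) has_integral - (0 - integral {0..S} (\<lambda>x. \<bar>\<psi> x\<bar>))) {0..T}"
    by (intro has_integral_neg) (simp add: S_def)
  then have "((\<lambda>t. - b * \<bar>\<psi> (- b * (T - t))\<bar>) has_integral integral {0..S} (\<lambda>x. \<bar>\<psi> x\<bar>)) {0..T}"
    by simp
  then have "integral {0..T} (\<lambda>t. - b * \<bar>\<psi> (- b * (T - t))\<bar>) = integral {0..S} (\<lambda>x. \<bar>\<psi> x\<bar>)"
    by (rule integral_unique)
  also have "\<dots> \<le> integral {0..S + 1} (\<lambda>x. \<bar>\<psi> x\<bar>)"
    by (intro integral_subset_le int) auto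
  also have "\<dots> = integral {0..1} (\<lambda>x. \<bar>\<psi> x\<bar>) + integral {1..S + 1} (\<lambda>x. \<bar>\<psi> x\<bar>)"
    using S by (intro Henstock_Kurzweil_Integration.integral_combine[symmetric] int) auto
  also have "integral {1..S + 1} (\<lambda>x. \<bar>\<psi> x\<bar>) = 0"
    by (intro integral_unique has_integral_is_0) (auto simp: out)
  finally have "integral {0..T} (\<lambda>t. - b * \<bar>\<psi> (- b * (T - t))\<bar>) \<le> integral {0..1} (\<lambda>x. \<bar>\<psi> x\<bar>)"
    by simp
  moreover have "(LINT t|lebesgue_on {0..T}. - b * \<bar>\<psi> (- b * (T - t))\<bar>) = integral {0..T} (\<lambda>t. - b * \<bar>\<psi> (- b * (T - t))\<bar>)"
    by (intro lebesgue_integral_eq_integral continuous_imp_integrable_real continuous_intros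
        continuous_on_compose2[OF outflow_profile_continuous[OF \<psi>, of UNIV]]) auto
  moreover have "(LINT x|lebesgue_on {0..1}. \<bar>\<psi> x\<bar>) = integral {0..1} (\<lambda>x. \<bar>\<psi> x\<bar>)"
    by (intro lebesgue_integral_eq_integral continuous_imp_integrable_real c) auto
  ultimately show ?thesis by linarith
qed

lemma outflow_profile_shift_norm_le:
  assumes \<psi>: "outflow_profile \<psi>" and "s \<ge> 0"
  shows "L2_norm (\<lambda>x. \<psi> (x + s)) \<le> L2_norm \<psi>"
  unfolding L2_norm_def real_sqrt_le_iff
  using assms outflow_profile_continuous[OF \<psi>]
  by (intro integral_shift_le[of "\<lambda>x. (\<psi> x)\<^sup>2"] continuous_intros) (auto simp: outflow_profile_def)

text \<open>The initial value, the source and the inflow contribute separately to the pairing with \<open>\<psi>\<close>.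
  The source acts for at most the transit time \<open>-1/b\<close>, which makes the bound uniform in \<open>T\<close>.\<close>

lemma mild_transport_bound:
  assumes w: "mild_transport_solution b f g w" and b: "b < 0"
    and f: "\<And>t. t \<ge> 0 \<Longrightarrow> \<bar>f t\<bar> \<le> F" and g: "\<And>t. t \<ge> 0 \<Longrightarrow> \<bar>g t\<bar> \<le> G"
    and T: "T \<ge> 0"
  shows "L2_norm (\<lambda>x. w x T) \<le> L2_norm (\<lambda>x. w x 0) + (F * (- 1 / b) + G)"
proof (cases "T = 0")
  case True
  have "F \<ge> 0" "G \<ge> 0" using f[of 0] g[of 0] by auto
  then have "0 \<le> F * (- 1 / b)" using b by (intro mult_nonneg_nonneg) (auto simp: field_simps)
  then show ?thesis using True \<open>G \<ge> 0\<close> by simp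
next
  case False
  with T have T: "T > 0" by simp
  have FG: "F \<ge> 0" "G \<ge> 0" using f[of 0] g[of 0] by auto
  have r: "- 1 / b \<ge> 0" using b by (simp add: field_simps)
  note L2 = w[unfolded mild_transport_solution_def, THEN conjunct1, rule_format]
  show ?thesis
  proof (rule L2_norm_le_by_duality)
    show "L2_on {0..1} (\<lambda>x. w x T)" using L2 T by simp
    show "0 \<le> L2_norm (\<lambda>x. w x 0) + (F * (- 1 / b) + G)"
      using FG r by (intro add_nonneg_nonneg mult_nonneg_nonneg L2_norm_nonneg)
    fix \<psi> assume \<psi>: "outflow_profile \<psi>"
    let ?A = "LINT x|lebesgue_on {0..1}. w x 0 * \<psi> (x - b * T)"
    let ?q = "\<lambda>t. f t * mild_source b \<psi> T t - b * g t * \<psi> (- b * (T - t))"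
    define N where "N = (LINT x|lebesgue_on {0..1}. \<bar>\<psi> x\<bar>)"
    have N: "N \<ge> 0" "N \<le> L2_norm \<psi>"
      using outflow_profile_abs_integral_le[OF \<psi>] by (simp_all add: N_def)
    let ?k = "\<lambda>t. F * (N * indicator {T - (- 1 / b)..} t) + G * (- b * \<bar>\<psi> (- b * (T - t))\<bar>)"
    have "\<bar>?A\<bar> \<le> L2_norm (\<lambda>x. w x 0) * L2_norm (\<lambda>x. \<psi> (x + - b * T))"
      using L2_Cauchy_Schwarz[OF L2[of 0] outflow_profile_L2_on[OF \<psi>, of "- b * T"]] by simp
    also have "\<dots> \<le> L2_norm (\<lambda>x. w x 0) * L2_norm \<psi>"
      using b T by (intro mult_left_mono L2_norm_nonneg outflow_profile_shift_norm_le \<psi>)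
        (simp add: mult_nonpos_nonneg)
    finally have A: "\<bar>?A\<bar> \<le> L2_norm (\<lambda>x. w x 0) * L2_norm \<psi>" .
    have i1: "integrable (lebesgue_on {0..T}) (\<lambda>t. F * (N * indicator {T - (- 1 / b)..} t))"
      using integral_tail_window(1)[OF r, of T] by simp
    have i2: "integrable (lebesgue_on {0..T}) (\<lambda>t. G * (- b * \<bar>\<psi> (- b * (T - t))\<bar>))"
      by (intro continuous_imp_integrable_real continuous_intros
        continuous_on_compose2[OF outflow_profile_continuous[OF \<psi>, of UNIV]]) auto
    have "\<bar>integral\<^sup>L (lebesgue_on {0..T}) ?q\<bar> \<le> integral\<^sup>L (lebesgue_on {0..T}) ?k"
    proof (rule abs_integral_le_dominating)
      show "integrable (lebesgue_on {0..T}) ?k" using i1 i2 by (rule Bochner_Integration.integrable_add)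
      fix t assume "t \<in> space (lebesgue_on {0..T})"
      then have t: "0 \<le> t" "t \<le> T" by auto
      have "\<bar>?q t\<bar> \<le> \<bar>f t\<bar> * \<bar>mild_source b \<psi> T t\<bar> + \<bar>g t\<bar> * (- b * \<bar>\<psi> (- b * (T - t))\<bar>)"
        using b abs_triangle_ineq4[of "f t * mild_source b \<psi> T t" "b * g t * \<psi> (- b * (T - t))"]
        by (simp add: abs_mult algebra_simps)
      also have "\<dots> \<le> ?k t"
        using mild_source_bound[OF \<psi> b t(2)] b FG f[OF t(1)] g[OF t(1)]
        by (intro add_mono mult_mono) (auto simp: N_def[symmetric] mult_nonpos_nonneg)
      finally show "\<bar>?q t\<bar> \<le> ?k t" .
    qed
    also have "\<dots> = F * (N * (LINT t|lebesgue_on {0..T}. indicator {T - (- 1 / b)..} t))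
        + G * (LINT t|lebesgue_on {0..T}. - b * \<bar>\<psi> (- b * (T - t))\<bar>)"
      unfolding Bochner_Integration.integral_add[OF i1 i2]
      by (simp only: Bochner_Integration.integral_mult_right_zero)
    also have "\<dots> \<le> F * (N * (- 1 / b)) + G * N"
      using FG N integral_tail_window(2)[OF r, of T] boundary_trace_integral[OF \<psi> b less_imp_le[OF T]]
      by (intro add_mono mult_left_mono) (auto simp: N_def)
    also have "\<dots> = (F * (- 1 / b) + G) * N" by (simp add: algebra_simps)
    also have "\<dots> \<le> (F * (- 1 / b) + G) * L2_norm \<psi>"
      using FG r N by (intro mult_left_mono add_nonneg_nonneg mult_nonneg_nonneg)
    finally have B: "\<bar>integral\<^sup>L (lebesgue_on {0..T}) ?q\<bar> \<le> (F * (- 1 / b) + G) * L2_norm \<psi>" .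
    have "(LINT x|lebesgue_on {0..1}. w x T * \<psi> x) = ?A + integral\<^sup>L (lebesgue_on {0..T}) ?q"
      using w \<psi> T unfolding mild_transport_solution_def by blast
    then show "\<bar>LINT x|lebesgue_on {0..1}. w x T * \<psi> x\<bar> \<le> (L2_norm (\<lambda>x. w x 0) + (F * (- 1 / b) + G)) * L2_norm \<psi>"
      using A B by (simp add: distrib_right)
  qed
qed

text \<open>After the transit time the initial value has left the interval.\<close>

lemma profile_past_outflow:
  assumes "outflow_profile \<psi>" "b < 0" "T \<ge> - 1 / b"
  shows "(LINT x|lebesgue_on {0..1}. w x * \<psi> (x - b * T)) = 0"
proof -
  have "- b * T \<ge> 1" using assms by (simp add: field_simps)
  then have "(LINT x|lebesgue_on {0..1}. w x * \<psi> (x - b * T)) = (LINT x|lebesgue_on {0..1::real}. 0)"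
    using assms(1) by (intro Bochner_Integration.integral_cong) (auto simp: outflow_profile_def)
  then show ?thesis by simp
qed

lemma mild_transport_finite_time_extinction:
  assumes w: "mild_transport_solution b (\<lambda>_. 0) (\<lambda>_. 0) w" and b: "b < 0" and T: "T \<ge> - 1 / b"
  shows "L2_norm (\<lambda>x. w x T) = 0"
proof -
  have T0: "T > 0" using T b by (smt (verit) divide_neg_neg)
  have "L2_norm (\<lambda>x. w x T) \<le> 0"
  proof (rule L2_norm_le_by_duality)
    show "L2_on {0..1} (\<lambda>x. w x T)" using w T0 by (simp add: mild_transport_solution_def)
    fix \<psi> assume \<psi>: "outflow_profile \<psi>"
    then show "\<bar>LINT x|lebesgue_on {0..1}. w x T * \<psi> x\<bar> \<le> 0 * L2_norm \<psi>"
      using w T0 profile_past_outflow[OF \<psi> b T] by (simp add: mild_transport_solution_def)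
  qed simp
  then show ?thesis using L2_norm_nonneg[of "\<lambda>x. w x T"] by simp
qed

text \<open>Makes the time integral in the mild form additive, which linearity of the equation needs.\<close>

lemma mild_integrand_integrable:
  assumes f: "continuous_on {0..} f" and g: "Linf_time g" and \<psi>: "outflow_profile \<psi>"
  shows "integrable (lebesgue_on {0..T}) (\<lambda>t. f t * mild_source b \<psi> T t - b * g t * \<psi> (- b * (T - t)))"
proof (rule Bochner_Integration.integrable_diff)
  show "integrable (lebesgue_on {0..T}) (\<lambda>t. f t * mild_source b \<psi> T t)"
    by (intro continuous_imp_integrable_real continuous_intros mild_source_continuous \<psi>
        continuous_on_subset[OF f]) auto
  have c: "continuous_on {0..T} (\<lambda>t. \<psi> (- b * (T - t)))"
    by (intro continuous_intros continuous_on_compose2[OF outflow_profile_continuous[OF \<psi>, of UNIV]]) auto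
  have gm: "g \<in> borel_measurable (lebesgue_on {0..T})"
    using g by (auto simp: Linf_time_def intro: measurable_restrict_mono)
  obtain G where G: "\<And>t. t \<ge> 0 \<Longrightarrow> \<bar>g t\<bar> \<le> G"
    using g by (auto simp: Linf_time_def bounded_iff)
  show "integrable (lebesgue_on {0..T}) (\<lambda>t. b * g t * \<psi> (- b * (T - t)))"
  proof (rule Bochner_Integration.integrable_bound)
    show "integrable (lebesgue_on {0..T}) (\<lambda>t. \<bar>b\<bar> * G * \<bar>\<psi> (- b * (T - t))\<bar>)"
      by (intro continuous_imp_integrable_real continuous_intros c)
    have "(\<lambda>t. \<psi> (- b * (T - t))) \<in> borel_measurable (lebesgue_on {0..T})"
      using c by (intro continuous_imp_measurable_on_sets_lebesgue) auto
    then show "(\<lambda>t. b * g t * \<psi> (- b * (T - t))) \<in> borel_measurable (lebesgue_on {0..T})"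
      using gm by (intro borel_measurable_times borel_measurable_const)
    show "AE t in lebesgue_on {0..T}. norm (b * g t * \<psi> (- b * (T - t))) \<le> norm (\<bar>b\<bar> * G * \<bar>\<psi> (- b * (T - t))\<bar>)"
    proof (rule AE_I2)
      fix t assume "t \<in> space (lebesgue_on {0..T})"
      then have "\<bar>g t\<bar> \<le> \<bar>G\<bar>" using G[of t] by auto
      then show "norm (b * g t * \<psi> (- b * (T - t))) \<le> norm (\<bar>b\<bar> * G * \<bar>\<psi> (- b * (T - t))\<bar>)"
        unfolding real_norm_def abs_mult abs_idempotent by (intro mult_mono) auto
    qed
  qed
qed

lemma mild_transport_lincomb:
  assumes w1: "mild_transport_solution b f1 g1 w1" and w2: "mild_transport_solution b f2 g2 w2"
    and f: "continuous_on {0..} f1" "continuous_on {0..} f2" and g: "Linf_time g1" "Linf_time g2"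
  shows "mild_transport_solution b (\<lambda>t. f1 t + c * f2 t) (\<lambda>t. g1 t + c * g2 t) (\<lambda>x t. w1 x t + c * w2 x t)"
  unfolding mild_transport_solution_def
proof (intro conjI allI impI)
  have L2: "L2_on {0..1} (\<lambda>x. w1 x t)" "L2_on {0..1} (\<lambda>x. w2 x t)" if "t \<ge> 0" for t
    using w1 w2 that by (auto simp: mild_transport_solution_def)
  show "L2_on {0..1} (\<lambda>x. w1 x t + c * w2 x t)" if "t \<ge> 0" for t
    using L2[OF that] by (rule L2_on_lincomb)
  fix \<psi> and T :: real assume \<psi>: "outflow_profile \<psi>" and T: "T > 0"
  have sum: "(LINT x|lebesgue_on {0..1}. (w1 x t + c * w2 x t) * \<psi> (x + s)) =
      (LINT x|lebesgue_on {0..1}. w1 x t * \<psi> (x + s)) + c * (LINT x|lebesgue_on {0..1}. w2 x t * \<psi> (x + s))"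
    if "t \<ge> 0" for t s
    using L2_on_mult_integrable[OF L2(1)[OF that] outflow_profile_L2_on[OF \<psi>, of s]]
      L2_on_mult_integrable[OF L2(2)[OF that] outflow_profile_L2_on[OF \<psi>, of s]]
    by (simp add: distrib_right mult.assoc)
  let ?q = "\<lambda>f g t. f t * mild_source b \<psi> T t - b * g t * \<psi> (- b * (T - t))"
  have "(LINT t|lebesgue_on {0..T}. ?q (\<lambda>t. f1 t + c * f2 t) (\<lambda>t. g1 t + c * g2 t) t) =
      (LINT t|lebesgue_on {0..T}. ?q f1 g1 t + c * ?q f2 g2 t)"
    by (intro Bochner_Integration.integral_cong) (auto simp: algebra_simps)
  also have "\<dots> = (LINT t|lebesgue_on {0..T}. ?q f1 g1 t) + c * (LINT t|lebesgue_on {0..T}. ?q f2 g2 t)"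
    using mild_integrand_integrable[OF f(1) g(1) \<psi>, of T b] mild_integrand_integrable[OF f(2) g(2) \<psi>, of T b]
    by (subst Bochner_Integration.integral_add) auto
  finally have src: "(LINT t|lebesgue_on {0..T}. ?q (\<lambda>t. f1 t + c * f2 t) (\<lambda>t. g1 t + c * g2 t) t) =
      (LINT t|lebesgue_on {0..T}. ?q f1 g1 t) + c * (LINT t|lebesgue_on {0..T}. ?q f2 g2 t)" .
  have m: "(LINT x|lebesgue_on {0..1}. w1 x T * \<psi> x) =
        (LINT x|lebesgue_on {0..1}. w1 x 0 * \<psi> (x - b * T)) + (LINT t|lebesgue_on {0..T}. ?q f1 g1 t)"
    "(LINT x|lebesgue_on {0..1}. w2 x T * \<psi> x) =
        (LINT x|lebesgue_on {0..1}. w2 x 0 * \<psi> (x - b * T)) + (LINT t|lebesgue_on {0..T}. ?q f2 g2 t)"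
    using w1 w2 \<psi> T unfolding mild_transport_solution_def by blast+
  show "(LINT x|lebesgue_on {0..1}. (w1 x T + c * w2 x T) * \<psi> x) =
        (LINT x|lebesgue_on {0..1}. (w1 x 0 + c * w2 x 0) * \<psi> (x - b * T)) +
        (LINT t|lebesgue_on {0..T}. ?q (\<lambda>t. f1 t + c * f2 t) (\<lambda>t. g1 t + c * g2 t) t)"
    using sum[of T 0] sum[of 0 "- b * T"] T unfolding src by (simp add: m distrib_left)
qed

text \<open>A nonnegative profile that is simple enough for an explicit lower bound of its source weight.\<close>

definition quadratic_profile :: "real \<Rightarrow> real" where
  "quadratic_profile x = (max 0 (1 - x))\<^sup>2"

lemma quadratic_profile: "outflow_profile quadratic_profile"
proof -
  have "outflow_profile (\<lambda>x. 1 * (max 0 (1 - x))\<^sup>2)"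
    by (rule outflow_profile_cutoff[where p' = "\<lambda>_. 0" and q' = "\<lambda>_. - 1"])
      (auto intro!: derivative_eq_intros continuous_intros)
  then show ?thesis by (simp add: quadratic_profile_def[abs_def])
qed

lemma quadratic_profile_source_nonneg: "0 \<le> mild_source b quadratic_profile T t"
  unfolding mild_source_def quadratic_profile_def by (intro Bochner_Integration.integral_nonneg) simp

text \<open>During the last quarter of the transit time the profile has been translated by at most \<open>1/4\<close>.
  It is then bounded below by an affine function with integral \<open>1/16\<close> over the unit interval.\<close>

lemma quadratic_profile_source_lower:
  assumes "b < 0" "T - (- 1 / (4 * b)) \<le> t"
  shows "1 / 16 \<le> mild_source b quadratic_profile T t"
proof -
  have "- b * (T - t) \<le> 1 / 4" using assms by (simp add: field_simps)
  then have le: "(3/4 - x) / 2 - 1/16 \<le> quadratic_profile (x - b * (T - t))" for x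
  proof -
    define y where "y = 1 - (x - b * (T - t))"
    have "y \<ge> 3/4 - x" using \<open>- b * (T - t) \<le> 1 / 4\<close> by (simp add: y_def)
    then have "(3/4 - x) / 2 - 1/16 \<le> y / 2 - 1/16" by simp
    also have "\<dots> \<le> (max 0 y)\<^sup>2"
    proof (cases "y \<ge> 0")
      case True
      have "0 \<le> (y - 1/4)\<^sup>2" by simp
      then show ?thesis using True by (simp add: power2_eq_square algebra_simps)
    qed simp
    finally show ?thesis by (simp add: quadratic_profile_def y_def)
  qed
  have "((\<lambda>x::real. (3/4 - x) / 2 - 1/16) has_integral (5/16 * 1 - 1\<^sup>2 / 4) - (5/16 * 0 - 0\<^sup>2 / 4)) {0..1}"
    by (rule fundamental_theorem_of_calculus[where f = "\<lambda>x. 5/16 * x - x\<^sup>2 / 4"])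
      (auto intro!: derivative_eq_intros simp: has_real_derivative_iff_has_vector_derivative[symmetric] field_simps)
  moreover have "((\<lambda>x. quadratic_profile (x - b * (T - t))) has_integral mild_source b quadratic_profile T t) {0..1}"
    unfolding mild_source_eq_integral[OF quadratic_profile]
    by (intro integrable_integral integrable_continuous_real continuous_intros
        continuous_on_compose2[OF outflow_profile_continuous[OF quadratic_profile, of UNIV]]) auto
  ultimately have "(5/16 * 1 - 1\<^sup>2 / 4) - (5/16 * 0 - 0\<^sup>2 / 4) \<le> mild_source b quadratic_profile T t"
    by (rule has_integral_le) (rule le)
  then show ?thesis by simp
qed

lemma quadratic_profile_norm_le: "L2_norm quadratic_profile \<le> 1"
proof -
  have "(LINT x|lebesgue_on {0..1}. (quadratic_profile x)\<^sup>2) \<le> (LINT x|lebesgue_on {0..1::real}. 1)"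
  proof (rule integral_mono)
    show "integrable (lebesgue_on {0..1}) (\<lambda>x. (quadratic_profile x)\<^sup>2)"
      using outflow_profile_continuous[OF quadratic_profile]
      by (intro continuous_imp_integrable_real continuous_intros)
    show "integrable (lebesgue_on {0..1}) (\<lambda>x::real. 1::real)"
      by (intro continuous_imp_integrable_real continuous_intros)
    show "(quadratic_profile x)\<^sup>2 \<le> 1" if "x \<in> space (lebesgue_on {0..1})" for x
      using that by (auto simp: quadratic_profile_def power_le_one)
  qed
  then show ?thesis by (simp add: L2_norm_def measure_restrict_space)
qed

text \<open>Only the values of \<open>f\<close> during the last transit time matter for the state at \<open>T\<close>, and there \<open>f\<close>
  has the constant sign \<open>\<sigma>\<close> and size at least \<open>\<delta>\<close>. Hence nothing cancels in the pairing with a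
  nonnegative profile, which bounds the norm from below.\<close>

lemma mild_transport_excitation:
  assumes w: "mild_transport_solution b f (\<lambda>_. 0) w" and b: "b < 0" and f: "continuous_on {0..} f"
    and \<delta>: "\<delta> > 0" and \<sigma>: "\<bar>\<sigma>\<bar> = 1" and S: "S \<ge> 0" "\<And>t. t \<ge> S \<Longrightarrow> \<delta> \<le> \<sigma> * f t" and T: "T \<ge> S - 1 / b"
  shows "\<delta> / 16 * (- 1 / (4 * b)) \<le> L2_norm (\<lambda>x. w x T)"
proof -
  let ?\<psi> = quadratic_profile
  let ?J = "mild_source b ?\<psi> T"
  have "1 / b < 0" using b by simp
  then have T0: "T > 0" "T \<ge> - 1 / b" using T S(1) by (linarith, simp)
  have r: "0 \<le> - 1 / (4 * b)" "- 1 / (4 * b) \<le> - 1 / b" using b by (auto simp: field_simps)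
  have "(LINT x|lebesgue_on {0..1}. w x T * ?\<psi> x) = (LINT t|lebesgue_on {0..T}. f t * ?J t)"
    using w quadratic_profile T0 profile_past_outflow[OF quadratic_profile b T0(2)]
    by (simp add: mild_transport_solution_def)
  then have eq: "\<sigma> * (LINT x|lebesgue_on {0..1}. w x T * ?\<psi> x) = (LINT t|lebesgue_on {0..T}. \<sigma> * (f t * ?J t))"
    by simp
  have "\<delta> / 16 * (- 1 / (4 * b)) = (LINT t|lebesgue_on {0..T}. \<delta> / 16 * indicator {T - (- 1 / (4 * b))..} t)"
    using integral_tail_window(3)[OF r(1), of T] r(2) T0(2) by simp
  also have "\<dots> \<le> (LINT t|lebesgue_on {0..T}. \<sigma> * (f t * ?J t))"
  proof (rule integral_mono)
    show "integrable (lebesgue_on {0..T}) (\<lambda>t. \<delta> / 16 * indicator {T - (- 1 / (4 * b))..} t)"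
      using integral_tail_window(1)[OF r(1), of T] by simp
    show "integrable (lebesgue_on {0..T}) (\<lambda>t. \<sigma> * (f t * ?J t))"
      by (intro continuous_imp_integrable_real continuous_intros mild_source_continuous quadratic_profile
        continuous_on_subset[OF f]) auto
    fix t assume "t \<in> space (lebesgue_on {0..T})"
    then have t: "0 \<le> t" "t \<le> T" by auto
    note J0 = quadratic_profile_source_nonneg[of b T t]
    (* Before the last transit time the weight is zero, then it is nonnegative, and during the last
       quarter it is at least 1/16. *)
    consider "t < T - (- 1 / b)" | "T - (- 1 / b) \<le> t" "t < T - (- 1 / (4 * b))" | "T - (- 1 / (4 * b)) \<le> t"
      by linarith
    then show "\<delta> / 16 * indicator {T - (- 1 / (4 * b))..} t \<le> \<sigma> * (f t * ?J t)"
    proof cases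
      case 1
      then show ?thesis using mild_source_bound[OF quadratic_profile b t(2)] r(2) by simp
    next
      case 2
      have "\<delta> \<le> \<sigma> * f t" using S(2)[of t] 2 T by simp
      then have "0 \<le> (\<sigma> * f t) * ?J t" using \<delta> J0 by (intro mult_nonneg_nonneg[OF _ J0]) linarith
      then show ?thesis using 2 by (simp add: mult.assoc)
    next
      case 3
      have "\<delta> \<le> \<sigma> * f t" using S(2)[of t] 3 r(2) T by simp
      then have "\<delta> * (1 / 16) \<le> (\<sigma> * f t) * ?J t"
        using quadratic_profile_source_lower[OF b 3] \<delta> by (intro mult_mono) auto
      then show ?thesis using 3 by (simp add: mult.assoc)
    qed
  qed
  also have "\<dots> \<le> \<bar>LINT x|lebesgue_on {0..1}. w x T * ?\<psi> x\<bar>"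
    unfolding eq[symmetric] using \<sigma> by (metis abs_ge_self abs_mult mult_1)
  also have "\<dots> \<le> L2_norm (\<lambda>x. w x T) * L2_norm ?\<psi>"
    using w T0 outflow_profile_L2_on[OF quadratic_profile, of 0]
    by (intro L2_Cauchy_Schwarz) (auto simp: mild_transport_solution_def)
  also have "\<dots> \<le> L2_norm (\<lambda>x. w x T) * 1"
    by (intro mult_left_mono quadratic_profile_norm_le L2_norm_nonneg)
  finally show ?thesis by simp
qed

section \<open>The two normalized gradient estimators\<close>
lemma has_time_derivative_imp_continuous:
  "has_time_derivative f f' \<Longrightarrow> continuous_on {0..} f"
  by (rule DERIV_continuous_on) auto

lemma time_derivative_eq:
  assumes "has_time_derivative f f'" "t \<ge> 0"
  shows "time_derivative f t = f' t"
proof (rule vector_derivative_within)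
  have "{0::real..} \<noteq> {x}" for x
  proof
    assume "{0::real..} = {x}"
    then have "0 \<in> {x}" "1 \<in> {x}" by auto
    then show False by simp
  qed
  then have "t islimpt {0..}"
    using assms(2) by (intro connected_imp_perfect) auto
  then show "at t within {0..} \<noteq> bot"
    by (simp add: trivial_limit_within)
  show "(f has_vector_derivative f' t) (at t within {0..})"
    using assms by (simp add: has_real_derivative_iff_has_vector_derivative[symmetric])
qed

text \<open>Square integrability and boundedness are both inherited from the dominating signal \<open>P\<close>. The
  statement is about a function \<open>g\<close> that is only known for \<open>t \<ge> 0\<close>, such as a time derivative.\<close>

lemma signal_in_L2_and_Linf:
  fixes f P :: "real \<Rightarrow> real"
  assumes f: "continuous_on {0..} f" and P: "integrable (lebesgue_on {0..}) P"
    and B: "\<And>t. t \<ge> 0 \<Longrightarrow> P t \<le> B" and "K \<ge> 0" and le: "\<And>t. t \<ge> 0 \<Longrightarrow> (f t)\<^sup>2 \<le> K * P t"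
    and eq: "\<And>t. t \<ge> 0 \<Longrightarrow> g t = f t"
  shows "L2_time g \<and> Linf_time g"
proof
  have g: "continuous_on {0..} g"
    using f by (rule continuous_on_eq) (simp add: eq)
  then have meas: "g \<in> borel_measurable (lebesgue_on {0..})"
    by (intro continuous_imp_measurable_on_sets_lebesgue) auto
  show "L2_time g"
    unfolding L2_on_def
  proof
    show "integrable (lebesgue_on {0..}) (\<lambda>t. (g t)\<^sup>2)"
    proof (rule Bochner_Integration.integrable_bound)
      show "integrable (lebesgue_on {0..}) (\<lambda>t. K * P t)" using P by simp
      show "(\<lambda>t. (g t)\<^sup>2) \<in> borel_measurable (lebesgue_on {0..})" using meas by simp
      show "AE t in lebesgue_on {0..}. norm ((g t)\<^sup>2) \<le> norm (K * P t)"
      proof (rule AE_I2)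
        fix t :: real assume "t \<in> space (lebesgue_on {0..})"
        then show "norm ((g t)\<^sup>2) \<le> norm (K * P t)" using le[of t] eq[of t] by simp
      qed
    qed
  qed (rule meas)
  show "Linf_time g"
  proof (rule Linf_time_of_continuous[OF g])
    fix t :: real assume t: "t \<ge> 0"
    have "(g t)\<^sup>2 \<le> K * B"
      using le[OF t] eq[OF t] mult_left_mono[OF B[OF t] \<open>K \<ge> 0\<close>] by simp
    then show "\<bar>g t\<bar> \<le> sqrt (K * B)"
      by (metis real_sqrt_abs real_sqrt_le_iff)
  qed
qed

text \<open>Here \<open>A\<close> is the squared prediction error, \<open>E\<close> the squared disturbance, \<open>I\<close> their inner product
  and \<open>n\<close> the squared regressor, so that \<open>A - I\<close> is the prediction error paired with the part of
  it that comes from the parameter error.\<close>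

lemma normalized_dissipation:
  fixes A :: real
  assumes "\<gamma> > 0" "n \<ge> 0" "E \<ge> 0" "2 * I \<le> A + E"
  shows "- 2 * \<gamma> * ((A - I) / (1 + n)) \<le> - \<gamma> * (A / (1 + n)) + \<gamma> * E"
proof -
  have "(A - 2 * (A - I)) / (1 + n) \<le> E / (1 + n)"
    using assms by (intro divide_right_mono) auto
  also have "\<dots> \<le> E"
    using assms mult_nonneg_nonneg[of E n] by (simp add: pos_divide_le_eq algebra_simps)
  finally have "\<gamma> * ((A - 2 * (A - I)) / (1 + n)) \<le> \<gamma> * E"
    by (rule mult_left_mono) (use \<open>\<gamma> > 0\<close> in simp)
  then show ?thesis by (simp add: algebra_simps add_divide_distrib diff_divide_distrib)
qed

text \<open>The difference from the limit satisfies the same equation with a forcing that tends to zero.\<close>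

lemma relaxation_limit:
  assumes der: "has_time_derivative y (\<lambda>t. - k * y t + h t)" and "k > 0" and h: "(h \<longlongrightarrow> h0) at_top"
  shows "(y \<longlongrightarrow> h0 / k) at_top"
proof -
  have "((\<lambda>t. y t - h0 / k) \<longlongrightarrow> 0) at_top"
  proof (rule tendsto_zero_of_linear_damping[where T = 0 and m = "\<lambda>_. 1" and l = 1 and \<gamma> = k and r = "\<lambda>t. (h0 - h t) / k"])
    fix t :: real assume t: "t \<ge> 0"
    have "((\<lambda>t. y t - h0 / k) has_real_derivative - k * y t + h t - 0) (at t within {0..})"
      using der t by (intro DERIV_diff DERIV_const) auto
    moreover have "- k * y t + h t - 0 = - k * (1 * (y t - h0 / k) + (h0 - h t) / k)"
      using \<open>k > 0\<close> by (simp add: field_simps)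
    ultimately show "((\<lambda>t. y t - h0 / k) has_real_derivative - k * (1 * (y t - h0 / k) + (h0 - h t) / k)) (at t within {0..})"
      by simp
  next
    have "((\<lambda>t. (h0 - h t) / k) \<longlongrightarrow> (h0 - h0) / k) at_top"
      using \<open>k > 0\<close> by (intro tendsto_intros h) auto
    then show "((\<lambda>t. (h0 - h t) / k) \<longlongrightarrow> 0) at_top" by simp
  qed (use \<open>k > 0\<close> in auto)
  then show ?thesis by (rule LIM_zero_cancel)
qed

lemma normalized_regressor_lower:
  fixes n l :: real
  assumes "l \<le> n" "0 \<le> l"
  shows "l / (1 + l) \<le> n / (1 + n)"
  using assms by (simp add: field_simps)

theorem lemma1:
  fixes a b b\<^sub>X U\<^sub>e \<gamma> \<gamma>\<^sub>3 Abar :: real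
    and u \<mu> \<xi> \<zeta> :: "real \<Rightarrow> real \<Rightarrow> real"
    and U X V \<Omega> \<Omega>\<^sub>0 \<epsilon> bhat\<^sub>X ahat :: "real \<Rightarrow> real"
  assumes "a > 0" "b < 0" "b\<^sub>X > 0"
    and "\<gamma> > 0" "\<gamma>\<^sub>3 > 0" "Abar < 0"
    and "Linf_time U"
    and "transport_solution b (\<lambda>t. b\<^sub>X * X t) (\<lambda>t. 2 * U\<^sub>e - U t) u"
    and "has_time_derivative X (\<lambda>t. - a * X t + V t)"
    and "has_time_derivative V (\<lambda>t. 0)"
    and "has_time_derivative \<Omega>\<^sub>0 (\<lambda>t. Abar * (\<Omega>\<^sub>0 t - X t) + V t)"
    and "has_time_derivative \<Omega> (\<lambda>t. Abar * \<Omega> t - X t)"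
    and "transport_solution b X (\<lambda>t. 0) \<mu>"
    and "transport_solution b (\<lambda>t. 0) (\<lambda>t. - U t + 2 * U\<^sub>e) \<xi>"
    and "\<And>x t. x \<in> {0..1} \<Longrightarrow> t \<ge> 0 \<Longrightarrow> \<zeta> x t = u x t - bhat\<^sub>X t * \<mu> x t - \<xi> x t"
    and "\<And>t. t \<ge> 0 \<Longrightarrow> \<epsilon> t = X t - \<Omega>\<^sub>0 t - \<Omega> t * ahat t"
    and "has_time_derivative bhat\<^sub>X
           (\<lambda>t. \<gamma> * ((LINT x|lebesgue_on {0..1}. \<zeta> x t * \<mu> x t)
                     / (1 + (LINT x|lebesgue_on {0..1}. (\<mu> x t)\<^sup>2))))"
    and "has_time_derivative ahat (\<lambda>t. \<gamma>\<^sub>3 * (\<epsilon> t * \<Omega> t / (1 + (\<Omega> t)\<^sup>2)))"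
  shows "Linf_time (\<lambda>t. L2_norm (\<lambda>x. u x t)) \<and> Linf_time V \<and> Linf_time X \<and>
         Linf_time (\<lambda>t. L2_norm (\<lambda>x. \<mu> x t)) \<and> Linf_time (\<lambda>t. L2_norm (\<lambda>x. \<xi> x t)) \<and>
         Linf_time \<Omega> \<and> Linf_time \<Omega>\<^sub>0 \<and>
         Linf_time (\<lambda>t. b\<^sub>X - bhat\<^sub>X t) \<and> Linf_time (\<lambda>t. a - ahat t) \<and>
         L2_time (time_derivative bhat\<^sub>X) \<and> Linf_time (time_derivative bhat\<^sub>X) \<and>
         L2_time (time_derivative ahat) \<and> Linf_time (time_derivative ahat) \<and>
         L2_time (\<lambda>t. L2_norm (\<lambda>x. \<zeta> x t) / sqrt (1 + (L2_norm (\<lambda>x. \<mu> x t))\<^sup>2)) \<and>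
         Linf_time (\<lambda>t. L2_norm (\<lambda>x. \<zeta> x t) / sqrt (1 + (L2_norm (\<lambda>x. \<mu> x t))\<^sup>2)) \<and>
         L2_time (\<lambda>t. \<bar>\<epsilon> t\<bar> / sqrt (1 + (\<Omega> t)\<^sup>2)) \<and>
         Linf_time (\<lambda>t. \<bar>\<epsilon> t\<bar> / sqrt (1 + (\<Omega> t)\<^sup>2)) \<and>
         (\<forall>c. V 0 = c \<and> c \<noteq> 0 \<longrightarrow>
            (bhat\<^sub>X \<longlongrightarrow> b\<^sub>X) at_top \<and> (ahat \<longlongrightarrow> a) at_top)"
proof -
  define c where "c = V 0"
  note D_X = assms(9) and D_V = assms(10) and D_\<Omega>\<^sub>0 = assms(11) and D_\<Omega> = assms(12)
  note D_bhat = assms(17) and D_ahat = assms(18)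
  note cont = D_X[THEN has_time_derivative_imp_continuous] D_V[THEN has_time_derivative_imp_continuous]
    D_\<Omega>\<^sub>0[THEN has_time_derivative_imp_continuous] D_\<Omega>[THEN has_time_derivative_imp_continuous]
    D_bhat[THEN has_time_derivative_imp_continuous] D_ahat[THEN has_time_derivative_imp_continuous]

  have V: "V t = c" if "t \<ge> 0" for t
  proof -
    obtain k where "\<forall>t\<in>{0..}. V t = k"
      using has_field_derivative_zero_constant[of "{0..}" V] D_V by auto
    then show ?thesis using that by (simp add: c_def)
  qed
  have V_lim: "(V \<longlongrightarrow> c) at_top"
    by (rule tendsto_eventually) (use eventually_ge_at_top[of 0] in eventually_elim, rule V)
  have X_lim: "(X \<longlongrightarrow> c / a) at_top"
    using relaxation_limit[OF D_X \<open>a > 0\<close> V_lim] .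
  have \<Omega>_lim: "(\<Omega> \<longlongrightarrow> c / a / Abar) at_top"
  proof -
    have "has_time_derivative \<Omega> (\<lambda>t. - (- Abar) * \<Omega> t + - X t)" using D_\<Omega> by simp
    from relaxation_limit[OF this _ tendsto_minus[OF X_lim]] show ?thesis using \<open>Abar < 0\<close> by simp
  qed
  obtain B_X where B_X: "\<And>t. t \<ge> 0 \<Longrightarrow> \<bar>X t\<bar> \<le> B_X" using bounded_of_convergent[OF cont(1) X_lim] by blast
  obtain B_\<Omega> where B_\<Omega>: "\<And>t. t \<ge> 0 \<Longrightarrow> \<bar>\<Omega> t\<bar> \<le> B_\<Omega>" using bounded_of_convergent[OF cont(4) \<Omega>_lim] by blast

  (* The part of the prediction error that the filters leave over when the true value of a is
     inserted; it decays whatever X and V are. *)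
  define \<eta> where "\<eta> = (\<lambda>t. X t - \<Omega>\<^sub>0 t - a * \<Omega> t)"
  have D_\<eta>: "has_time_derivative \<eta> (\<lambda>t. Abar * \<eta> t)"
  proof (intro allI impI)
    fix t :: real assume t: "t \<ge> 0"
    have "(\<eta> has_real_derivative (- a * X t + V t) - (Abar * (\<Omega>\<^sub>0 t - X t) + V t) - a * (Abar * \<Omega> t - X t)) (at t within {0..})"
      unfolding \<eta>_def using D_X D_\<Omega>\<^sub>0 D_\<Omega> t by (intro DERIV_diff DERIV_cmult) auto
    then show "(\<eta> has_real_derivative Abar * \<eta> t) (at t within {0..})"
      by (simp add: \<eta>_def algebra_simps)
  qed
  have \<eta>_cont: "continuous_on {0..} \<eta>" using D_\<eta> by (rule has_time_derivative_imp_continuous)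
  have \<eta>_lim: "(\<eta> \<longlongrightarrow> 0) at_top"
    using relaxation_limit[of \<eta> "- Abar" "\<lambda>_. 0" 0] D_\<eta> \<open>Abar < 0\<close> by simp
  obtain B_\<eta> where B_\<eta>: "\<And>t. t \<ge> 0 \<Longrightarrow> \<bar>\<eta> t\<bar> \<le> B_\<eta>" using bounded_of_convergent[OF \<eta>_cont \<eta>_lim] by blast
  have \<eta>_energy: "integral {0..T} (\<lambda>t. (\<eta> t)\<^sup>2) \<le> (\<eta> 0)\<^sup>2 / (- 2 * Abar)" if "T \<ge> 0" for T
  proof -
    have "((\<lambda>t. 2 * Abar * (\<eta> t)\<^sup>2) has_integral (\<eta> T)\<^sup>2 - (\<eta> 0)\<^sup>2) {0..T}"
    proof (rule fundamental_theorem_of_calculus[OF that, where f = "\<lambda>t. (\<eta> t)\<^sup>2"])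
      fix t assume t: "t \<in> {0..T}"
      have "(\<eta> has_real_derivative Abar * \<eta> t) (at t within {0..T})"
        by (rule has_time_derivative_subset[OF D_\<eta>]) (use t in auto)
      then have "((\<lambda>t. (\<eta> t)\<^sup>2) has_real_derivative 2 * Abar * (\<eta> t)\<^sup>2) (at t within {0..T})"
        by (auto intro!: derivative_eq_intros simp: power2_eq_square)
      then show "((\<lambda>t. (\<eta> t)\<^sup>2) has_vector_derivative 2 * Abar * (\<eta> t)\<^sup>2) (at t within {0..T})"
        by (simp add: has_real_derivative_iff_has_vector_derivative)
    qed
    from integral_unique[OF this] have "2 * Abar * integral {0..T} (\<lambda>t. (\<eta> t)\<^sup>2) = (\<eta> T)\<^sup>2 - (\<eta> 0)\<^sup>2"
      by simp
    then have "- 2 * Abar * integral {0..T} (\<lambda>t. (\<eta> t)\<^sup>2) \<le> (\<eta> 0)\<^sup>2"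
      using zero_le_power2[of "\<eta> T"] by linarith
    then show ?thesis using \<open>Abar < 0\<close> by (simp add: field_simps)
  qed

  define \<alpha> where "\<alpha> = (\<lambda>t. a - ahat t)"
  have \<epsilon>_eq: "\<epsilon> t = \<alpha> t * \<Omega> t + \<eta> t" if "t \<ge> 0" for t
    using assms(16)[OF that] by (simp add: \<alpha>_def \<eta>_def algebra_simps)
  have D_\<alpha>: "has_time_derivative \<alpha> (\<lambda>t. - (\<gamma>\<^sub>3 * (\<epsilon> t * \<Omega> t / (1 + (\<Omega> t)\<^sup>2))))"
    unfolding \<alpha>_def using D_ahat by (auto intro!: derivative_eq_intros)
  have \<alpha>_cont: "continuous_on {0..} \<alpha>" using D_\<alpha> by (rule has_time_derivative_imp_continuous)
  have \<epsilon>_cont: "continuous_on {0..} \<epsilon>"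
  proof (rule continuous_on_eq)
    show "continuous_on {0..} (\<lambda>t. \<alpha> t * \<Omega> t + \<eta> t)" by (intro continuous_intros \<alpha>_cont cont \<eta>_cont)
  qed (simp add: \<epsilon>_eq)
  have nz: "1 + (\<Omega> t)\<^sup>2 \<noteq> 0" "1 + (\<Omega> t)\<^sup>2 > 0" for t
    using zero_le_power2[of "\<Omega> t"] by (linarith, linarith)
  define P\<^sub>a where "P\<^sub>a = (\<lambda>t. (\<epsilon> t)\<^sup>2 / (1 + (\<Omega> t)\<^sup>2))"
  have P\<^sub>a_cont: "continuous_on {0..} P\<^sub>a"
    unfolding P\<^sub>a_def by (intro continuous_intros \<epsilon>_cont cont ballI nz)
  (* The parameter error times the regressor is the prediction error minus the disturbance. *)
  have diss_a: "2 * \<alpha> t * (- (\<gamma>\<^sub>3 * (\<epsilon> t * \<Omega> t / (1 + (\<Omega> t)\<^sup>2)))) \<le> - \<gamma>\<^sub>3 * P\<^sub>a t + \<gamma>\<^sub>3 * (\<eta> t)\<^sup>2" if t: "t \<ge> 0" for t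
  proof -
    have "2 * \<alpha> t * (- (\<gamma>\<^sub>3 * (\<epsilon> t * \<Omega> t / (1 + (\<Omega> t)\<^sup>2)))) = - 2 * \<gamma>\<^sub>3 * (\<epsilon> t * (\<alpha> t * \<Omega> t) / (1 + (\<Omega> t)\<^sup>2))"
      by simp
    also have "\<epsilon> t * (\<alpha> t * \<Omega> t) = (\<epsilon> t)\<^sup>2 - \<epsilon> t * \<eta> t"
      using \<epsilon>_eq[OF t] by (simp add: power2_eq_square algebra_simps)
    also have "- 2 * \<gamma>\<^sub>3 * (((\<epsilon> t)\<^sup>2 - \<epsilon> t * \<eta> t) / (1 + (\<Omega> t)\<^sup>2)) \<le> - \<gamma>\<^sub>3 * P\<^sub>a t + \<gamma>\<^sub>3 * (\<eta> t)\<^sup>2"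
      unfolding P\<^sub>a_def using \<open>\<gamma>\<^sub>3 > 0\<close> sum_squares_bound[of "\<epsilon> t" "\<eta> t"] by (intro normalized_dissipation) auto
    finally show ?thesis .
  qed
  have \<eta>2_cont: "continuous_on {0..} (\<lambda>t. (\<eta> t)\<^sup>2)" by (intro continuous_intros \<eta>_cont)
  have P\<^sub>a_nonneg: "0 \<le> P\<^sub>a t" for t using nz(2)[of t] by (simp add: P\<^sub>a_def)
  note est_a = normalized_gradient_estimator[OF D_\<alpha> P\<^sub>a_cont P\<^sub>a_nonneg \<eta>2_cont \<eta>_energy \<open>\<gamma>\<^sub>3 > 0\<close> diss_a]
  obtain B_\<alpha> where B_\<alpha>: "\<And>t. t \<ge> 0 \<Longrightarrow> \<bar>\<alpha> t\<bar> \<le> B_\<alpha>" using est_a(1) by blast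
  have P\<^sub>a_bound: "P\<^sub>a t \<le> (B_\<alpha> * B_\<Omega> + B_\<eta>)\<^sup>2" if t: "t \<ge> 0" for t
  proof -
    have "\<bar>\<alpha> t * \<Omega> t\<bar> \<le> B_\<alpha> * B_\<Omega>"
      unfolding abs_mult using B_\<alpha>[OF t] B_\<Omega>[OF t] by (intro mult_mono) auto
    then have "\<bar>\<epsilon> t\<bar> \<le> \<bar>B_\<alpha> * B_\<Omega> + B_\<eta>\<bar>" using \<epsilon>_eq[OF t] B_\<eta>[OF t] by linarith
    then have "(\<epsilon> t)\<^sup>2 \<le> (B_\<alpha> * B_\<Omega> + B_\<eta>)\<^sup>2" by (simp add: abs_le_square_iff)
    moreover have "P\<^sub>a t \<le> (\<epsilon> t)\<^sup>2 / 1"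
      unfolding P\<^sub>a_def by (intro divide_left_mono) (auto simp: nz)
    ultimately show ?thesis by simp
  qed
  have ahat_signal: "L2_time (time_derivative ahat) \<and> Linf_time (time_derivative ahat)"
  proof (rule signal_in_L2_and_Linf[OF _ est_a(2) P\<^sub>a_bound, of _ "\<gamma>\<^sub>3\<^sup>2"])
    show "continuous_on {0..} (\<lambda>t. \<gamma>\<^sub>3 * (\<epsilon> t * \<Omega> t / (1 + (\<Omega> t)\<^sup>2)))"
      by (intro continuous_intros \<epsilon>_cont cont ballI nz)
    show "(\<gamma>\<^sub>3 * (\<epsilon> t * \<Omega> t / (1 + (\<Omega> t)\<^sup>2)))\<^sup>2 \<le> \<gamma>\<^sub>3\<^sup>2 * P\<^sub>a t" for t
    proof -
      have "(\<epsilon> t * \<Omega> t / (1 + (\<Omega> t)\<^sup>2))\<^sup>2 = P\<^sub>a t * ((\<Omega> t)\<^sup>2 / (1 + (\<Omega> t)\<^sup>2))"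
        by (simp add: P\<^sub>a_def power_divide power_mult_distrib power2_eq_square)
      also have "\<dots> \<le> P\<^sub>a t * 1"
        using nz(2)[of t] P\<^sub>a_nonneg[of t] by (intro mult_left_mono) auto
      finally have "(\<epsilon> t * \<Omega> t / (1 + (\<Omega> t)\<^sup>2))\<^sup>2 \<le> P\<^sub>a t" by simp
      then show ?thesis
        unfolding power_mult_distrib[of \<gamma>\<^sub>3] by (rule mult_left_mono) simp
    qed
  qed (simp_all add: time_derivative_eq[OF D_ahat])
  have \<epsilon>_signal: "L2_time (\<lambda>t. \<bar>\<epsilon> t\<bar> / sqrt (1 + (\<Omega> t)\<^sup>2)) \<and> Linf_time (\<lambda>t. \<bar>\<epsilon> t\<bar> / sqrt (1 + (\<Omega> t)\<^sup>2))"
  proof (rule signal_in_L2_and_Linf[OF _ est_a(2) P\<^sub>a_bound, of _ 1])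
    show "continuous_on {0..} (\<lambda>t. \<bar>\<epsilon> t\<bar> / sqrt (1 + (\<Omega> t)\<^sup>2))"
      using nz(1) by (intro continuous_intros \<epsilon>_cont cont) auto
    show "(\<bar>\<epsilon> t\<bar> / sqrt (1 + (\<Omega> t)\<^sup>2))\<^sup>2 \<le> 1 * P\<^sub>a t" for t
      using nz(2)[of t] by (simp add: P\<^sub>a_def power_divide)
  qed simp_all
  have ahat_lim: "(ahat \<longlongrightarrow> a) at_top" if "c \<noteq> 0"
  proof -
    (* Half of the limit of the squared regressor, so that the regressor exceeds it eventually. *)
    define l where "l = (c / a / Abar)\<^sup>2 / 2"
    have l: "l > 0" using that \<open>a > 0\<close> \<open>Abar < 0\<close> by (simp add: l_def)
    have "((\<lambda>t. (\<Omega> t)\<^sup>2) \<longlongrightarrow> (c / a / Abar)\<^sup>2) at_top" by (intro tendsto_intros \<Omega>_lim)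
    then have "\<forall>\<^sub>F t in at_top. l < (\<Omega> t)\<^sup>2"
      by (rule order_tendstoD(1)) (use l in \<open>simp add: l_def\<close>)
    then obtain S where S: "\<And>t. t \<ge> S \<Longrightarrow> l < (\<Omega> t)\<^sup>2" by (auto simp: eventually_at_top_linorder)
    have "(\<alpha> \<longlongrightarrow> 0) at_top"
    proof (rule tendsto_zero_of_linear_damping[where T = "max S 0" and \<gamma> = \<gamma>\<^sub>3 and l = "l / (1 + l)"
          and m = "\<lambda>t. (\<Omega> t)\<^sup>2 / (1 + (\<Omega> t)\<^sup>2)" and r = "\<lambda>t. \<eta> t * \<Omega> t / (1 + (\<Omega> t)\<^sup>2)"])
      fix t assume t: "t \<ge> max S 0"
      have "(\<alpha> has_real_derivative - (\<gamma>\<^sub>3 * (\<epsilon> t * \<Omega> t / (1 + (\<Omega> t)\<^sup>2)))) (at t within {max S 0..})"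
        by (rule has_time_derivative_subset[OF D_\<alpha>]) (use t in auto)
      moreover have "\<epsilon> t * \<Omega> t / (1 + (\<Omega> t)\<^sup>2) = (\<Omega> t)\<^sup>2 / (1 + (\<Omega> t)\<^sup>2) * \<alpha> t + \<eta> t * \<Omega> t / (1 + (\<Omega> t)\<^sup>2)"
        using t \<epsilon>_eq[of t] by (simp add: power2_eq_square distrib_left distrib_right add_divide_distrib mult_ac)
      ultimately show "(\<alpha> has_real_derivative - \<gamma>\<^sub>3 * ((\<Omega> t)\<^sup>2 / (1 + (\<Omega> t)\<^sup>2) * \<alpha> t + \<eta> t * \<Omega> t / (1 + (\<Omega> t)\<^sup>2)))
          (at t within {max S 0..})" by simp
      show "l / (1 + l) \<le> (\<Omega> t)\<^sup>2 / (1 + (\<Omega> t)\<^sup>2)"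
        using S[of t] t l by (intro normalized_regressor_lower) auto
    next
      have "((\<lambda>t. \<eta> t * \<Omega> t / (1 + (\<Omega> t)\<^sup>2)) \<longlongrightarrow> 0 * (c / a / Abar) / (1 + (c / a / Abar)\<^sup>2)) at_top"
        by (intro tendsto_intros \<eta>_lim \<Omega>_lim) (smt (verit) zero_le_power2)
      then show "((\<lambda>t. \<eta> t * \<Omega> t / (1 + (\<Omega> t)\<^sup>2)) \<longlongrightarrow> 0) at_top" by simp
    qed (use l \<open>\<gamma>\<^sub>3 > 0\<close> in auto)
    then have "((\<lambda>t. a - \<alpha> t) \<longlongrightarrow> a - 0) at_top" by (intro tendsto_intros)
    then show ?thesis by (simp add: \<alpha>_def)
  qed

  obtain B_U where B_U: "\<And>t. t \<ge> 0 \<Longrightarrow> \<bar>U t\<bar> \<le> B_U"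
    using assms(7) by (auto simp: Linf_time_def bounded_iff)
  have inflow: "Linf_time (\<lambda>t. 2 * U\<^sub>e - U t)" and zero: "Linf_time (\<lambda>t. 0)"
  proof -
    have "(\<lambda>t. 2 * U\<^sub>e - U t) \<in> borel_measurable (lebesgue_on {0..})"
      using assms(7) by (auto simp: Linf_time_def)
    moreover have "\<bar>2 * U\<^sub>e - U t\<bar> \<le> \<bar>2 * U\<^sub>e\<bar> + B_U" if "t \<ge> 0" for t
      using B_U[OF that] by linarith
    ultimately show "Linf_time (\<lambda>t. 2 * U\<^sub>e - U t)"
      unfolding Linf_time_def bounded_iff by auto
    show "Linf_time (\<lambda>t. 0)" by (rule Linf_time_of_continuous[where B = 0]) auto
  qed
  have \<xi>_sol: "transport_solution b (\<lambda>t. 0) (\<lambda>t. 2 * U\<^sub>e - U t) \<xi>"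
    using assms(14) by (simp add: algebra_simps)
  note mild = assms(8)[THEN transport_solution_imp_mild, OF \<open>b < 0\<close>]
    assms(13)[THEN transport_solution_imp_mild, OF \<open>b < 0\<close>]
    \<xi>_sol[THEN transport_solution_imp_mild, OF \<open>b < 0\<close>]
  note curve = assms(8)[THEN transport_solution_imp_curve] assms(13)[THEN transport_solution_imp_curve]
    \<xi>_sol[THEN transport_solution_imp_curve]
  have B_in: "\<bar>2 * U\<^sub>e - U t\<bar> \<le> \<bar>2 * U\<^sub>e\<bar> + B_U" if "t \<ge> 0" for t
    using B_U[OF that] by linarith
  have "\<bar>b\<^sub>X * X t\<bar> \<le> b\<^sub>X * B_X" if "t \<ge> 0" for t
    using B_X[OF that] \<open>b\<^sub>X > 0\<close> by (simp add: abs_mult)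
  then obtain B_u where B_u: "\<And>t. t \<ge> 0 \<Longrightarrow> L2_norm (\<lambda>x. u x t) \<le> B_u"
    using mild_transport_bound[OF mild(1) \<open>b < 0\<close> _ B_in] by blast
  obtain B_\<mu> where B_\<mu>: "\<And>t. t \<ge> 0 \<Longrightarrow> L2_norm (\<lambda>x. \<mu> x t) \<le> B_\<mu>"
    using mild_transport_bound[OF mild(2) \<open>b < 0\<close> B_X, of 0] by auto
  obtain B_\<xi> where B_\<xi>: "\<And>t. t \<ge> 0 \<Longrightarrow> L2_norm (\<lambda>x. \<xi> x t) \<le> B_\<xi>"
    using mild_transport_bound[OF mild(3) \<open>b < 0\<close> _ B_in, of 0] by auto
  have norm_Linf: "Linf_time (\<lambda>t. L2_norm (\<lambda>x. w x t))"
    if "L2_curve w" "\<And>t. t \<ge> 0 \<Longrightarrow> L2_norm (\<lambda>x. w x t) \<le> B" for w B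
    using that by (intro Linf_time_of_continuous[OF L2_curve_norm_continuous]) (auto simp: L2_norm_nonneg)

  (* The prediction error for the true value of b_X. Its source and its inflow cancel. *)
  define e where "e = (\<lambda>x t. (u x t + (- b\<^sub>X) * \<mu> x t) + (- 1) * \<xi> x t)"
  have e_curve: "L2_curve e"
    unfolding e_def by (intro L2_curve_lincomb curve continuous_on_const)
  have e_mild: "mild_transport_solution b (\<lambda>_. 0) (\<lambda>_. 0) e"
  proof -
    have "mild_transport_solution b (\<lambda>t. (b\<^sub>X * X t + (- b\<^sub>X) * X t) + (- 1) * 0)
        (\<lambda>t. ((2 * U\<^sub>e - U t) + (- b\<^sub>X) * 0) + (- 1) * (2 * U\<^sub>e - U t)) e"
      unfolding e_def using inflow zero
      by (intro mild_transport_lincomb mild continuous_intros cont) auto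
    then show ?thesis by simp
  qed
  define E where "E = L2_norm (\<lambda>x. e x 0)"
  have e_bound: "L2_norm (\<lambda>x. e x t) \<le> E" if "t \<ge> 0" for t
    using mild_transport_bound[OF e_mild \<open>b < 0\<close>, of 0 0 t] that by (simp add: E_def)
  have e_zero: "L2_norm (\<lambda>x. e x t) = 0" if "t \<ge> - 1 / b" for t
    using mild_transport_finite_time_extinction[OF e_mild \<open>b < 0\<close> that] .
  define Q where "Q = (\<lambda>t. (L2_norm (\<lambda>x. e x t))\<^sup>2)"
  have Q_cont: "continuous_on A Q" if "A \<subseteq> {0..}" for A
    unfolding Q_def using that L2_curve_norm_continuous[OF e_curve] by (intro continuous_intros) (rule continuous_on_subset)
  have r: "- 1 / b > 0" using \<open>b < 0\<close> by (simp add: field_simps)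
  have Q_energy: "integral {0..T} Q \<le> E\<^sup>2 * (- 1 / b)" if "T \<ge> 0" for T
  proof -
    (* The energy is collected before the transit time; extending the interval to T + ?r avoids a
       case distinction between T and ?r. *)
    let ?r = "- 1 / b"
    have int: "Q integrable_on {p..q}" if "p \<ge> 0" for p q
      using that by (intro integrable_continuous_real Q_cont) auto
    have "integral {0..T} Q \<le> integral {0..T + ?r} Q"
      using r by (intro integral_subset_le int) (auto simp: Q_def)
    also have "\<dots> = integral {0..?r} Q + integral {?r..T + ?r} Q"
      using r that by (intro Henstock_Kurzweil_Integration.integral_combine[symmetric] int) auto
    also have "integral {?r..T + ?r} Q = 0"
      by (intro integral_unique has_integral_is_0) (simp add: Q_def e_zero)
    also have "integral {0..?r} Q \<le> integral {0..?r} (\<lambda>t. E\<^sup>2)"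
    proof (rule integral_le)
      show "Q t \<le> E\<^sup>2" if "t \<in> {0..?r}" for t
        using that e_bound[of t] by (simp add: Q_def power_mono L2_norm_nonneg)
    qed (auto intro: int)
    also have "\<dots> = E\<^sup>2 * ?r" using r by simp
    finally show ?thesis by simp
  qed

  define \<beta> where "\<beta> = (\<lambda>t. b\<^sub>X - bhat\<^sub>X t)"
  (* An everywhere defined version of zeta, which is specified on the unit interval only. *)
  define z where "z = (\<lambda>x t. (u x t + (- bhat\<^sub>X t) * \<mu> x t) + (- 1) * \<xi> x t)"
  have z_curve: "L2_curve z"
    unfolding z_def by (intro L2_curve_lincomb curve continuous_intros cont)
  have z_eq: "z x t = e x t + \<beta> t * \<mu> x t" for x t
    by (simp add: z_def e_def \<beta>_def algebra_simps)
  have \<zeta>_eq: "\<zeta> x t = z x t" if "x \<in> {0..1}" "t \<ge> 0" for x t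
    using assms(15)[OF that] by (simp add: z_def)
  have \<zeta>_norm: "L2_norm (\<lambda>x. \<zeta> x t) = L2_norm (\<lambda>x. z x t)" if "t \<ge> 0" for t
    using that by (intro L2_norm_cong \<zeta>_eq)
  define n where "n = (\<lambda>t. (L2_norm (\<lambda>x. \<mu> x t))\<^sup>2)"
  have n0: "n t \<ge> 0" "1 + n t > 0" "1 + n t \<noteq> 0" for t
    using zero_le_power2[of "L2_norm (\<lambda>x. \<mu> x t)"] unfolding n_def by linarith+
  define J where "J = (\<lambda>t. LINT x|lebesgue_on {0..1}. z x t * \<mu> x t)"
  have L2: "L2_on {0..1} (\<lambda>x. z x t)" "L2_on {0..1} (\<lambda>x. \<mu> x t)" "L2_on {0..1} (\<lambda>x. e x t)" if "t \<ge> 0" for t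
    using z_curve curve(2) e_curve that by (auto simp: L2_curve_def)
  have D_bhat': "has_time_derivative bhat\<^sub>X (\<lambda>t. \<gamma> * (J t / (1 + n t)))"
  proof (intro allI impI)
    fix t :: real assume t: "t \<ge> 0"
    have "(LINT x|lebesgue_on {0..1}. \<zeta> x t * \<mu> x t) = J t"
      unfolding J_def using t by (intro Bochner_Integration.integral_cong) (auto simp: \<zeta>_eq)
    moreover have "(LINT x|lebesgue_on {0..1}. (\<mu> x t)\<^sup>2) = n t"
      by (simp add: n_def L2_norm_square)
    ultimately show "(bhat\<^sub>X has_real_derivative \<gamma> * (J t / (1 + n t))) (at t within {0..})"
      using D_bhat t by metis
  qed
  have D_\<beta>: "has_time_derivative \<beta> (\<lambda>t. - (\<gamma> * (J t / (1 + n t))))"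
    unfolding \<beta>_def using D_bhat' by (auto intro!: derivative_eq_intros)
  have n_cont: "continuous_on {0..} n"
    unfolding n_def by (intro continuous_intros L2_curve_norm_continuous curve)
  have J_cont: "continuous_on {0..} J"
    unfolding J_def by (intro L2_curve_inner_continuous z_curve curve)
  define P\<^sub>b where "P\<^sub>b = (\<lambda>t. (L2_norm (\<lambda>x. z x t))\<^sup>2 / (1 + n t))"
  have P\<^sub>b_cont: "continuous_on {0..} P\<^sub>b"
    unfolding P\<^sub>b_def by (intro continuous_intros L2_curve_norm_continuous z_curve n_cont ballI n0)
  have P\<^sub>b_nonneg: "0 \<le> P\<^sub>b t" for t using n0(2)[of t] by (simp add: P\<^sub>b_def)
  have diss_b: "2 * \<beta> t * (- (\<gamma> * (J t / (1 + n t)))) \<le> - \<gamma> * P\<^sub>b t + \<gamma> * Q t" if t: "t \<ge> 0" for t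
  proof -
    (* As beta * mu = z - e, pairing with z expresses the gradient through z and e alone. *)
    let ?I = "LINT x|lebesgue_on {0..1}. z x t * e x t"
    have "\<beta> t * J t = (LINT x|lebesgue_on {0..1}. (z x t)\<^sup>2 - z x t * e x t)"
      unfolding J_def integral_mult_right_zero[symmetric]
      by (intro Bochner_Integration.integral_cong) (auto simp: z_eq power2_eq_square algebra_simps)
    also have "\<dots> = (L2_norm (\<lambda>x. z x t))\<^sup>2 - ?I"
      unfolding L2_norm_square using L2(1)[OF t] L2_on_mult_integrable[OF L2(1,3)[OF t]]
      by (intro Bochner_Integration.integral_diff) (auto simp: L2_on_def)
    finally have pairing: "\<beta> t * J t = (L2_norm (\<lambda>x. z x t))\<^sup>2 - ?I" .
    have "2 * \<beta> t * (- (\<gamma> * (J t / (1 + n t)))) = - 2 * \<gamma> * (\<beta> t * J t / (1 + n t))"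
      by simp
    also have "\<dots> = - 2 * \<gamma> * (((L2_norm (\<lambda>x. z x t))\<^sup>2 - ?I) / (1 + n t))"
      unfolding pairing ..
    also have "\<dots> \<le> - \<gamma> * P\<^sub>b t + \<gamma> * Q t"
      unfolding P\<^sub>b_def Q_def
    proof (rule normalized_dissipation)
      have "2 * ?I \<le> 2 * (L2_norm (\<lambda>x. z x t) * L2_norm (\<lambda>x. e x t))"
        using L2_Cauchy_Schwarz[OF L2(1,3)[OF t]] by linarith
      also have "\<dots> \<le> (L2_norm (\<lambda>x. z x t))\<^sup>2 + (L2_norm (\<lambda>x. e x t))\<^sup>2"
        using sum_squares_bound[of "L2_norm (\<lambda>x. z x t)" "L2_norm (\<lambda>x. e x t)"] by simp
      finally show "2 * ?I \<le> (L2_norm (\<lambda>x. z x t))\<^sup>2 + (L2_norm (\<lambda>x. e x t))\<^sup>2" .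
    qed (use \<open>\<gamma> > 0\<close> n0 in auto)
    finally show ?thesis .
  qed
  note est_b = normalized_gradient_estimator[OF D_\<beta> P\<^sub>b_cont P\<^sub>b_nonneg Q_cont[OF order_refl] Q_energy \<open>\<gamma> > 0\<close> diss_b]
  obtain B_\<beta> where B_\<beta>: "\<And>t. t \<ge> 0 \<Longrightarrow> \<bar>\<beta> t\<bar> \<le> B_\<beta>" using est_b(1) by blast
  (* The normalization by 1 + n only decreases the squared prediction error, which is bounded since
     e, the parameter error and mu are. *)
  have P\<^sub>b_bound: "P\<^sub>b t \<le> (E + B_\<beta> * B_\<mu>)\<^sup>2" if t: "t \<ge> 0" for t
  proof -
    have "L2_norm (\<lambda>x. z x t) \<le> L2_norm (\<lambda>x. e x t) + L2_norm (\<lambda>x. \<beta> t * \<mu> x t)"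
      unfolding z_eq using L2[OF t] by (intro L2_norm_triangle L2_on_scale)
    also have "\<dots> \<le> E + B_\<beta> * B_\<mu>"
      unfolding L2_norm_scale using e_bound[OF t] B_\<beta>[OF t] B_\<mu>[OF t]
      by (intro add_mono mult_mono) (auto simp: L2_norm_nonneg)
    finally have "(L2_norm (\<lambda>x. z x t))\<^sup>2 \<le> (E + B_\<beta> * B_\<mu>)\<^sup>2" by (intro power_mono L2_norm_nonneg)
    moreover have "P\<^sub>b t \<le> (L2_norm (\<lambda>x. z x t))\<^sup>2 / 1"
      unfolding P\<^sub>b_def using n0[of t] by (intro divide_left_mono) auto
    ultimately show ?thesis by simp
  qed
  have bhat_signal: "L2_time (time_derivative bhat\<^sub>X) \<and> Linf_time (time_derivative bhat\<^sub>X)"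
  proof (rule signal_in_L2_and_Linf[OF _ est_b(2) P\<^sub>b_bound, of _ "\<gamma>\<^sup>2"])
    show "continuous_on {0..} (\<lambda>t. \<gamma> * (J t / (1 + n t)))"
      by (intro continuous_intros J_cont n_cont ballI n0)
    show "(\<gamma> * (J t / (1 + n t)))\<^sup>2 \<le> \<gamma>\<^sup>2 * P\<^sub>b t" if t: "t \<ge> 0" for t
    proof -
      have "(J t)\<^sup>2 \<le> (L2_norm (\<lambda>x. z x t) * L2_norm (\<lambda>x. \<mu> x t))\<^sup>2"
        using L2_Cauchy_Schwarz[OF L2(1,2)[OF t]] by (simp add: J_def abs_le_square_iff[symmetric])
      then have "(J t)\<^sup>2 / (1 + n t)\<^sup>2 \<le> (L2_norm (\<lambda>x. z x t))\<^sup>2 * n t / (1 + n t)\<^sup>2"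
        by (intro divide_right_mono) (auto simp: n_def power_mult_distrib)
      also have "\<dots> = P\<^sub>b t * (n t / (1 + n t))"
        by (simp add: P\<^sub>b_def power2_eq_square)
      also have "\<dots> \<le> P\<^sub>b t * 1"
        using n0[of t] P\<^sub>b_nonneg[of t] by (intro mult_left_mono) auto
      finally have "(J t / (1 + n t))\<^sup>2 \<le> P\<^sub>b t" by (simp add: power_divide)
      then show ?thesis
        unfolding power_mult_distrib[of \<gamma>] by (rule mult_left_mono) simp
    qed
  qed (simp_all add: time_derivative_eq[OF D_bhat'])
  have \<zeta>_signal: "L2_time (\<lambda>t. L2_norm (\<lambda>x. \<zeta> x t) / sqrt (1 + (L2_norm (\<lambda>x. \<mu> x t))\<^sup>2)) \<and>
      Linf_time (\<lambda>t. L2_norm (\<lambda>x. \<zeta> x t) / sqrt (1 + (L2_norm (\<lambda>x. \<mu> x t))\<^sup>2))"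
  proof (rule signal_in_L2_and_Linf[OF _ est_b(2) P\<^sub>b_bound, of _ 1])
    show "continuous_on {0..} (\<lambda>t. L2_norm (\<lambda>x. z x t) / sqrt (1 + n t))"
      using n0 by (intro continuous_intros L2_curve_norm_continuous z_curve n_cont) auto
    show "(L2_norm (\<lambda>x. z x t) / sqrt (1 + n t))\<^sup>2 \<le> 1 * P\<^sub>b t" for t
      using n0[of t] by (simp add: P\<^sub>b_def power_divide)
  qed (simp_all add: \<zeta>_norm n_def)
  (* After the transit time the forcing e is extinct, so the error equation is homogeneous and only
     the lower bound on the norm of mu remains to be supplied. *)
  have bhat_lim: "(bhat\<^sub>X \<longlongrightarrow> b\<^sub>X) at_top" if "c \<noteq> 0"
  proof -
    (* Half of the limit of sgn c * X; the factor sgn c treats both signs of c at once. *)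
    define \<delta> where "\<delta> = \<bar>c\<bar> / a / 2"
    have \<delta>: "\<delta> > 0" using that \<open>a > 0\<close> by (simp add: \<delta>_def)
    have "((\<lambda>t. sgn c * X t) \<longlongrightarrow> sgn c * (c / a)) at_top" by (intro tendsto_intros X_lim)
    then have "\<forall>\<^sub>F t in at_top. \<delta> < sgn c * X t"
      by (rule order_tendstoD(1)) (use \<delta> in \<open>simp add: \<delta>_def abs_sgn mult.commute\<close>)
    then obtain S0 where S0: "\<And>t. t \<ge> S0 \<Longrightarrow> \<delta> < sgn c * X t" by (auto simp: eventually_at_top_linorder)
    define S where "S = max S0 0"
    (* From T on, the disturbance e is extinct, and the memory of the state mu only reaches back to
       times after S. *)
    define T where "T = S - 1 / b"
    have S: "S \<ge> 0" "\<And>t. t \<ge> S \<Longrightarrow> \<delta> \<le> sgn c * X t" using S0 by (auto simp: S_def intro: less_imp_le)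
    have "1 / b < 0" using \<open>b < 0\<close> by simp
    then have T: "T \<ge> 0" "T \<ge> - 1 / b" using S(1) unfolding T_def by (linarith, simp)
    define l where "l = (\<delta> / 16 * (- 1 / (4 * b)))\<^sup>2"
    have pos: "\<delta> / 16 * (- 1 / (4 * b)) > 0" using \<delta> \<open>b < 0\<close> by (simp add: field_simps)
    have l: "l > 0" unfolding l_def using pos by (rule zero_less_power)
    have n_low: "l \<le> n t" if "t \<ge> T" for t
      unfolding l_def n_def
      using mild_transport_excitation[OF mild(2) \<open>b < 0\<close> cont(1) \<delta> _ S, of t] that pos \<open>c \<noteq> 0\<close>
      by (intro power_mono) (auto simp: T_def abs_sgn_eq)
    have "(\<beta> \<longlongrightarrow> 0) at_top"
    proof (rule tendsto_zero_of_linear_damping[where T = T and \<gamma> = \<gamma> and l = "l / (1 + l)"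
          and m = "\<lambda>t. n t / (1 + n t)" and r = "\<lambda>t. 0"])
      fix t assume t: "t \<ge> T"
      then have t0: "t \<ge> 0" using T by simp
      have "(LINT x|lebesgue_on {0..1}. e x t * \<mu> x t) = 0"
        using L2_Cauchy_Schwarz[OF L2(3,2)[OF t0]] e_zero[of t] t T by simp
      moreover have "J t = (LINT x|lebesgue_on {0..1}. e x t * \<mu> x t + \<beta> t * (\<mu> x t)\<^sup>2)"
        unfolding J_def by (intro Bochner_Integration.integral_cong) (auto simp: z_eq power2_eq_square algebra_simps)
      moreover have "\<dots> = (LINT x|lebesgue_on {0..1}. e x t * \<mu> x t) + \<beta> t * n t"
        unfolding n_def L2_norm_square using L2(2)[OF t0] L2_on_mult_integrable[OF L2(3,2)[OF t0]]
        by (subst Bochner_Integration.integral_add) (auto simp: L2_on_def)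
      ultimately have "J t = \<beta> t * n t" by simp
      moreover have "(\<beta> has_real_derivative - (\<gamma> * (J t / (1 + n t)))) (at t within {T..})"
        by (rule has_time_derivative_subset[OF D_\<beta>]) (use t0 T in auto)
      ultimately show "(\<beta> has_real_derivative - \<gamma> * (n t / (1 + n t) * \<beta> t + 0)) (at t within {T..})"
        by (simp add: mult.commute)
      show "l / (1 + l) \<le> n t / (1 + n t)"
        using n_low[OF t] l by (intro normalized_regressor_lower) auto
    qed (use l \<open>\<gamma> > 0\<close> in auto)
    then have "((\<lambda>t. b\<^sub>X - \<beta> t) \<longlongrightarrow> b\<^sub>X - 0) at_top" by (intro tendsto_intros)
    then show ?thesis by (simp add: \<beta>_def)
  qed

  have "Linf_time V"
    by (rule Linf_time_of_continuous[OF cont(2), of "\<bar>c\<bar>"]) (simp add: V)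
  moreover have "Linf_time X" "Linf_time \<Omega>"
    using B_X B_\<Omega> by (auto intro: Linf_time_of_continuous cont)
  moreover have "Linf_time \<Omega>\<^sub>0"
  proof (rule Linf_time_of_continuous[OF cont(3)])
    fix t :: real assume t: "t \<ge> 0"
    have "\<bar>a * \<Omega> t\<bar> \<le> a * B_\<Omega>" using B_\<Omega>[OF t] \<open>a > 0\<close> by (simp add: abs_mult)
    then show "\<bar>\<Omega>\<^sub>0 t\<bar> \<le> B_X + a * B_\<Omega> + B_\<eta>"
      using B_X[OF t] B_\<eta>[OF t] unfolding \<eta>_def by linarith
  qed
  moreover have "Linf_time (\<lambda>t. b\<^sub>X - bhat\<^sub>X t)" "Linf_time (\<lambda>t. a - ahat t)"
    using Linf_time_of_continuous[OF has_time_derivative_imp_continuous[OF D_\<beta>] B_\<beta>]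
      Linf_time_of_continuous[OF \<alpha>_cont B_\<alpha>] by (simp_all add: \<beta>_def \<alpha>_def)
  ultimately show ?thesis
    using norm_Linf[OF curve(1) B_u] norm_Linf[OF curve(2) B_\<mu>] norm_Linf[OF curve(3) B_\<xi>]
      ahat_signal bhat_signal \<epsilon>_signal \<zeta>_signal ahat_lim bhat_lim
    by (simp add: c_def)
qed

end
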